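(* (a) The isometric finite quotients of a universal embedding of a finite connected graph $G$ are exactly the finite-index sublattices $L\subseteq\mathbb{Z}^f$ of the free part whose folds pass the exact check, and the minimal host over them is found by enumerating Hermite-normal-form bases in increasing index, each verified by breadth-first search in the finite Cayley graph. (b) Restricting to diagonal $L$ can miss the optimum: for the diamond graph the universal embedding has $f=2$ with labels $(0,0),(1,0),(1,1),(2,1)$; every diagonal fold of index $6$ fails, yet the non-diagonal sublattice $L=\langle(3,0),(1,2)\rangle$ of index $6$ yields an isometric host of order $6$, namely the octahedron $\mathrm{Cay}(\mathbb{Z}_2\times\mathbb{Z}_3,\{\pm(0,1),\pm(1,1)\})$.
   Context: An oriented partition of $G$ is a partition $\{F_1,\dots,F_t\}$ of $E(G)$ with a chosen (forward) direction for each edge. Its signed cycle–class matrix $A\in\mathbb{Z}^{c\times t}$, $c=|E(G)|-|V(G)|+1$, with respect to a cycle basis $B_1,\dots,B_c$ of $G$ (cycles whose edge sets form a basis over $\mathbb{F}_2$ of the cycle space, each traversed in a fixed rotational sense), has $A[i,j]$ equal to the net signed number of crossings of $F_j$ by $B_i$ (forward $+1$, backward $-1$). The universal group is $\Gamma_{\mathrm{univ}}=\mathbb{Z}^t/\mathrm{rowlattice}(A)$, with $\mathrm{rowlattice}(A)$ the lattice generated by the rows of $A$; it is identified by the Smith normal form with $T\times\mathbb{Z}^f$, $T$ a finite torsion group and $\mathbb{Z}^f$ the free part. $g_j$ is the image of the $j$-th standard basis vector. The universal embedding is the labeling $\phi(v)=\sum_{e\in P(r,v)}\pm g_{\mathrm{class}(e)}$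 of $V(G)$ in $\Gamma_{\mathrm{univ}}$ along a path from a fixed root $r$ to $v$ (sign $+$ for forward, $-$ for backward traversal), where $\mathrm{class}(e)=j$ if $e\in F_j$, with connection set $\{\pm g_j: g_j\ne0\}$. An isometric finite quotient of the universal embedding is a finite abelian quotient group of $\Gamma_{\mathrm{univ}}$, with the induced labels and with connection set the nonzero images of the $\pm g_j$, that is injective and distance-preserving on the labels (Cayley distance between the labels of $u$ and $v$ equals $d_G(u,v)$ for all $u,v$). The fold by a finite-index sublattice $L\subseteq\mathbb{Z}^f$ is the finite quotient group $\Gamma_L=\Gamma_{\mathrm{univ}}/L$ with the induced labels and connection set; the host is the resulting finite Cayley graph and its order is $|\Gamma_L|$. The exact check compares all $\binom{n}{2}$ distances, $n=|V(G)|$, in $G$ with the distances between labels found by breadth-first search in the finite Cayley graph; a fold fails if it does not pass this check. $L$ is diagonal if $L=N_1\mathbb{Z}\times\cdots\times N_f\mathbb{Z}$. Index means index in $\mathbb{Z}^f$. $\mathrm{Cay}(\Gamma,S)$ is the graph on $\Gamma$ with edges $\{h,h+s\}$, $s\in S$; $d_G$ is the shortest-path metric of $G$. The diamond is $K_4$ minus an edge, on vertices $0,1,2,3$ with single non-edge $\{0,3\}$; the labels in (b) are those of $0,1,2,3$ in this order, and arise from the oriented partition $\{0\to1,\;2\to3\}$, $\{0\to2,\;1\to3\}$, $\{1\to2\}$ with $\Gamma_{\mathrm{univ}}\cong\mathbb{Z}^2$ and class generators $(1,0)$, $(1,1)$, $(0,1)$ respectively.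
   Formalization: In (a), if T is nontrivial, "exactly" (and the minimal host) concerns only isometric finite quotients whose kernel lies in the free part; for trivial T all are covered. The unrestricted claim fails, e.g. for C_4 with universal group Z_2 x Z and a quotient Z_8. *)

theory Defs
  imports
    "Jordan_Normal_Form.Matrix"
    "Jordan_Normal_Form.Determinant"
    "HOL-Algebra.Elementary_Groups"
    "HOL-Algebra.Generated_Groups"
    "HOL-Library.While_Combinator"
    "HOL-Library.Extended_Nat"
begin

section \<open>Graphs\<close>

definition simple_graph :: "'a set \<Rightarrow> 'a set set \<Rightarrow> bool" where
  "simple_graph V E \<longleftrightarrow> (\<forall>e\<in>E. \<exists>u\<in>V. \<exists>v\<in>V. u \<noteq> v \<and> e = {u, v})"

definition walk :: "'a set \<Rightarrow> 'a set set \<Rightarrow> 'a list \<Rightarrow> bool" where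
  "walk V E p \<longleftrightarrow> p \<noteq> [] \<and> set p \<subseteq> V \<and> successively (\<lambda>x y. {x, y} \<in> E) p"

text \<open>Shortest-path metric; it is \<open>\<infinity>\<close> between vertices not joined by a walk.\<close>

definition gdist :: "'a set \<Rightarrow> 'a set set \<Rightarrow> 'a \<Rightarrow> 'a \<Rightarrow> enat" where
  "gdist V E u v = (INF p \<in> {p. walk V E p \<and> hd p = u \<and> last p = v}. enat (length p - 1))"

definition path_between :: "'a set \<Rightarrow> 'a set set \<Rightarrow> 'a \<Rightarrow> 'a \<Rightarrow> 'a list \<Rightarrow> bool" where
  "path_between V E u v p \<longleftrightarrow> walk V E p \<and> distinct p \<and> hd p = u \<and> last p = v"

definition finite_connected_graph :: "'a set \<Rightarrow> 'a set set \<Rightarrow> bool" where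
  "finite_connected_graph V E \<longleftrightarrow> finite V \<and> V \<noteq> {} \<and> simple_graph V E \<and>
     (\<forall>u\<in>V. \<forall>v\<in>V. \<exists>p. path_between V E u v p)"

definition graph_isomorphic :: "'a set \<Rightarrow> 'a set set \<Rightarrow> 'b set \<Rightarrow> 'b set set \<Rightarrow> bool" where
  "graph_isomorphic V E W D \<longleftrightarrow>
     (\<exists>h. bij_betw h V W \<and> (\<forall>u\<in>V. \<forall>v\<in>V. {u, v} \<in> E \<longleftrightarrow> {h u, h v} \<in> D))"

section \<open>Oriented partitions and cycle bases\<close>

definition steps :: "'a list \<Rightarrow> ('a \<times> 'a) list" where
  "steps p = zip p (tl p)"

text \<open>The classes are given as sets of arcs, each arc being an edge in its forward direction;
  the underlying edge sets of the classes partition \<open>E\<close>.\<close>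

definition edge_of :: "'a \<times> 'a \<Rightarrow> 'a set" where
  "edge_of a = {fst a, snd a}"

definition oriented_partition :: "'a set set \<Rightarrow> ('a \<times> 'a) set list \<Rightarrow> bool" where
  "oriented_partition E Fs \<longleftrightarrow>
     (\<forall>j<length Fs. Fs ! j \<noteq> {}) \<and>
     (\<forall>i<length Fs. \<forall>j<length Fs. i \<noteq> j \<longrightarrow> Fs ! i \<inter> Fs ! j = {}) \<and>
     bij_betw edge_of (\<Union>(set Fs)) E"

definition net_crossing :: "('a \<times> 'a) set \<Rightarrow> 'a list \<Rightarrow> int" where
  "net_crossing F p =
     (\<Sum>(u, v) \<leftarrow> steps p. (if (u, v) \<in> F then 1 else 0) - (if (v, u) \<in> F then 1 else 0))"

text \<open>A cycle is the list of its vertices in the order of traversal, the first one not repeated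
  at the end.\<close>

definition is_cycle :: "'a set \<Rightarrow> 'a set set \<Rightarrow> 'a list \<Rightarrow> bool" where
  "is_cycle V E b \<longleftrightarrow> 3 \<le> length b \<and> distinct b \<and> walk V E (b @ [hd b])"

definition cycle_edges :: "'a list \<Rightarrow> 'a set set" where
  "cycle_edges b = edge_of ` set (steps (b @ [hd b]))"

text \<open>Vectors over the two-element field indexed by \<open>E\<close> are represented by their supports, so
  addition is symmetric difference.\<close>

definition cycle_space :: "'a set \<Rightarrow> 'a set set \<Rightarrow> 'a set set set" where
  "cycle_space V E = {D. D \<subseteq> E \<and> (\<forall>v\<in>V. even (card {e \<in> D. v \<in> e}))}"

definition f2_sum :: "'a list list \<Rightarrow> nat set \<Rightarrow> 'a set set" where
  "f2_sum Bs I = {e. odd (card {i \<in> I. e \<in> cycle_edges (Bs ! i)})}"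

definition cycle_basis :: "'a set \<Rightarrow> 'a set set \<Rightarrow> 'a list list \<Rightarrow> bool" where
  "cycle_basis V E Bs \<longleftrightarrow>
     (\<forall>b\<in>set Bs. is_cycle V E b) \<and>
     (\<forall>I \<subseteq> {..<length Bs}. f2_sum Bs I = {} \<longrightarrow> I = {}) \<and>
     (\<forall>D \<in> cycle_space V E. \<exists>I \<subseteq> {..<length Bs}. D = f2_sum Bs I)"

definition cycle_class_matrix :: "('a \<times> 'a) set list \<Rightarrow> 'a list list \<Rightarrow> int mat" where
  "cycle_class_matrix Fs Bs =
     mat (length Bs) (length Fs) (\<lambda>(i, j). net_crossing (Fs ! j) (Bs ! i @ [hd (Bs ! i)]))"

section \<open>The universal embedding\<close>

abbreviation Zvec :: "nat \<Rightarrow> int vec monoid" where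
  "Zvec n \<equiv> monoid_vec TYPE(int) n"

definition row_lattice :: "int mat \<Rightarrow> int vec set" where
  "row_lattice A = generate (Zvec (dim_col A)) (set (rows A))"

definition univ_group :: "('a \<times> 'a) set list \<Rightarrow> 'a list list \<Rightarrow> int vec set monoid" where
  "univ_group Fs Bs = Zvec (length Fs) Mod row_lattice (cycle_class_matrix Fs Bs)"

definition univ_gen :: "('a \<times> 'a) set list \<Rightarrow> 'a list list \<Rightarrow> nat \<Rightarrow> int vec set" where
  "univ_gen Fs Bs j =
     row_lattice (cycle_class_matrix Fs Bs) #>\<^bsub>Zvec (length Fs)\<^esub> unit_vec (length Fs) j"

definition signed_gen :: "('a \<times> 'a) set list \<Rightarrow> 'a list list \<Rightarrow> 'a \<times> 'a \<Rightarrow> int vec set" where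
  "signed_gen Fs Bs a =
     (if a \<in> \<Union>(set Fs) then univ_gen Fs Bs (THE j. j < length Fs \<and> a \<in> Fs ! j)
      else inv\<^bsub>univ_group Fs Bs\<^esub>
             univ_gen Fs Bs (THE j. j < length Fs \<and> prod.swap a \<in> Fs ! j))"

definition path_sum :: "('a \<times> 'a) set list \<Rightarrow> 'a list list \<Rightarrow> 'a list \<Rightarrow> int vec set" where
  "path_sum Fs Bs p =
     foldr (\<lambda>a x. signed_gen Fs Bs a \<otimes>\<^bsub>univ_group Fs Bs\<^esub> x) (steps p) \<one>\<^bsub>univ_group Fs Bs\<^esub>"

text \<open>A choice of one path \<open>P v\<close> from the root \<open>r\<close> to every vertex \<open>v\<close>.\<close>

definition root_paths :: "'a set \<Rightarrow> 'a set set \<Rightarrow> 'a \<Rightarrow> ('a \<Rightarrow> 'a list) \<Rightarrow> bool" where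
  "root_paths V E r P \<longleftrightarrow> r \<in> V \<and> (\<forall>v\<in>V. path_between V E r v (P v))"

text \<open>A vertex labelling in a group with a distinguished list of class generators. Groups are
  abelian but written multiplicatively, following \<^theory>\<open>HOL-Algebra.Group\<close>.\<close>

record ('a, 'b) embedding =
  host :: "'b monoid"
  gens :: "'b list"
  lab :: "'a \<Rightarrow> 'b"

definition universal_embedding ::
    "('a \<times> 'a) set list \<Rightarrow> 'a list list \<Rightarrow> ('a \<Rightarrow> 'a list) \<Rightarrow> ('a, int vec set) embedding" where
  "universal_embedding Fs Bs P =
     \<lparr>host = univ_group Fs Bs,
      gens = map (univ_gen Fs Bs) [0..<length Fs],
      lab = (\<lambda>v. path_sum Fs Bs (P v))\<rparr>"

definition connection_set :: "('a, 'b) embedding \<Rightarrow> 'b set" where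
  "connection_set X =
     (set (gens X) \<union> (\<lambda>g. inv\<^bsub>host X\<^esub> g) ` set (gens X)) - {\<one>\<^bsub>host X\<^esub>}"

definition cayley_edges :: "'b monoid \<Rightarrow> 'b set \<Rightarrow> 'b set set" where
  "cayley_edges \<Gamma> S = {{h, h \<otimes>\<^bsub>\<Gamma>\<^esub> s} | h s. h \<in> carrier \<Gamma> \<and> s \<in> S}"

definition isometric :: "'a set \<Rightarrow> 'a set set \<Rightarrow> ('a, 'b) embedding \<Rightarrow> bool" where
  "isometric V E X \<longleftrightarrow> inj_on (lab X) V \<and>
     (\<forall>u\<in>V. \<forall>v\<in>V.
        gdist (carrier (host X)) (cayley_edges (host X) (connection_set X)) (lab X u) (lab X v)
          = gdist V E u v)"

section \<open>Finite quotients and folds\<close>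

definition quotient_embedding ::
    "('a, 'b) embedding \<Rightarrow> 'b set \<Rightarrow> ('a, 'b set) embedding" where
  "quotient_embedding X H =
     \<lparr>host = host X Mod H,
      gens = map (\<lambda>g. H #>\<^bsub>host X\<^esub> g) (gens X),
      lab = (\<lambda>v. H #>\<^bsub>host X\<^esub> lab X v)\<rparr>"

text \<open>A quotient group is specified by its kernel \<open>H\<close>.\<close>

definition isometric_finite_quotient ::
    "'a set \<Rightarrow> 'a set set \<Rightarrow> ('a, 'b) embedding \<Rightarrow> 'b set \<Rightarrow> bool" where
  "isometric_finite_quotient V E X H \<longleftrightarrow>
     subgroup H (host X) \<and> finite (carrier (host X Mod H)) \<and>
     isometric V E (quotient_embedding X H)"

definition lattice_index :: "nat \<Rightarrow> int vec set \<Rightarrow> nat" where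
  "lattice_index f L = card (rcosets\<^bsub>Zvec f\<^esub> L)"

definition finite_index_sublattice :: "nat \<Rightarrow> int vec set \<Rightarrow> bool" where
  "finite_index_sublattice f L \<longleftrightarrow> subgroup L (Zvec f) \<and> finite (rcosets\<^bsub>Zvec f\<^esub> L)"

text \<open>Below, \<open>\<psi>\<close> is an isomorphism from \<^term>\<open>host X\<close> to \<^term>\<open>T \<times>\<times> Zvec f\<close>, and the sublattice
  \<open>L\<close> of the free part is transported back along it. If \<open>T\<close> is nontrivial, a subgroup of finite
  index need not arise from a sublattice of the free part, for any choice of \<open>\<psi>\<close>.\<close>

definition fold_kernel ::
    "('a, 'b) embedding \<Rightarrow> 't monoid \<Rightarrow> ('b \<Rightarrow> 't \<times> int vec) \<Rightarrow> int vec set \<Rightarrow> 'b set" where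
  "fold_kernel X T \<psi> L = {x \<in> carrier (host X). \<psi> x \<in> {\<one>\<^bsub>T\<^esub>} \<times> L}"

definition free_part ::
    "('a, 'b) embedding \<Rightarrow> 't monoid \<Rightarrow> nat \<Rightarrow> ('b \<Rightarrow> 't \<times> int vec) \<Rightarrow> 'b set" where
  "free_part X T f \<psi> = fold_kernel X T \<psi> (carrier (Zvec f))"

definition fold_by ::
    "('a, 'b) embedding \<Rightarrow> 't monoid \<Rightarrow> ('b \<Rightarrow> 't \<times> int vec) \<Rightarrow> int vec set
       \<Rightarrow> ('a, 'b set) embedding" where
  "fold_by X T \<psi> L = quotient_embedding X (fold_kernel X T \<psi> L)"

definition diagonal_lattice :: "nat \<Rightarrow> int vec set \<Rightarrow> bool" where
  "diagonal_lattice f L \<longleftrightarrow>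
     (\<exists>N :: nat \<Rightarrow> nat. (\<forall>i<f. 0 < N i) \<and>
        L = {x \<in> carrier_vec f. \<forall>i<f. int (N i) dvd x $ i})"

section \<open>Exact check by breadth-first search\<close>

text \<open>The state consists of the current depth, the visited vertices and the frontier.\<close>

definition bfs_step ::
    "'b monoid \<Rightarrow> 'b set \<Rightarrow> nat \<times> 'b set \<times> 'b set \<Rightarrow> nat \<times> 'b set \<times> 'b set" where
  "bfs_step \<Gamma> S = (\<lambda>(k, vis, fr).
     let new = {h \<otimes>\<^bsub>\<Gamma>\<^esub> s | h s. h \<in> fr \<and> s \<in> S} - vis
     in (Suc k, vis \<union> new, new))"

definition bfs_dist :: "'b monoid \<Rightarrow> 'b set \<Rightarrow> 'b \<Rightarrow> 'b \<Rightarrow> enat" where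
  "bfs_dist \<Gamma> S x y =
     (case while_option (\<lambda>(k, vis, fr). y \<notin> fr \<and> fr \<noteq> {}) (bfs_step \<Gamma> S) (0, {x}, {x}) of
        None \<Rightarrow> \<infinity>
      | Some (k, vis, fr) \<Rightarrow> if y \<in> fr then enat k else \<infinity>)"

definition passes_exact_check :: "'a set \<Rightarrow> 'a set set \<Rightarrow> ('a, 'b) embedding \<Rightarrow> bool" where
  "passes_exact_check V E X \<longleftrightarrow>
     (\<forall>u\<in>V. \<forall>v\<in>V. u \<noteq> v \<longrightarrow>
        bfs_dist (host X) (connection_set X) (lab X u) (lab X v) = gdist V E u v)"

section \<open>Enumeration of Hermite normal forms\<close>

text \<open>Row-style, lower triangular convention: the rows are the basis vectors.\<close>

definition is_hnf :: "nat \<Rightarrow> int mat \<Rightarrow> bool" where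
  "is_hnf f B \<longleftrightarrow> B \<in> carrier_mat f f \<and>
     (\<forall>i<f. \<forall>j<f. i < j \<longrightarrow> B $$ (i, j) = 0) \<and>
     (\<forall>i<f. 0 < B $$ (i, i)) \<and>
     (\<forall>i<f. \<forall>j<i. 0 \<le> B $$ (i, j) \<and> B $$ (i, j) < B $$ (j, j))"

text \<open>All Hermite normal forms of determinant \<open>N\<close>; their entries are at most \<open>N\<close>.\<close>

definition hnf_list :: "nat \<Rightarrow> nat \<Rightarrow> int mat list" where
  "hnf_list f N =
     filter (\<lambda>B. is_hnf f B \<and> det B = int N)
       (map (\<lambda>xs. mat f f (\<lambda>(i, j). xs ! (i * f + j)))
         (product_lists (replicate (f * f) [0..int N])))"

text \<open>Goes through the indices \<open>1, 2, 3, \<dots>\<close> until some basis of that index satisfies \<open>check\<close>, and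
  returns the first such basis; \<^const>\<open>None\<close> stands for nontermination.\<close>

definition hnf_search :: "nat \<Rightarrow> (int mat \<Rightarrow> bool) \<Rightarrow> int mat option" where
  "hnf_search f check =
     map_option (\<lambda>N. the (List.find check (hnf_list f N)))
       (while_option (\<lambda>N. List.find check (hnf_list f N) = None) Suc 1)"

section \<open>The diamond and the octahedron\<close>

definition diamond_V :: "nat set" where
  "diamond_V = {0, 1, 2, 3}"

definition diamond_E :: "nat set set" where
  "diamond_E = {{u, v} | u v. u \<in> diamond_V \<and> v \<in> diamond_V \<and> u \<noteq> v} - {{0, 3}}"

definition diamond_F :: "(nat \<times> nat) set list" where
  "diamond_F = [{(0, 1), (2, 3)}, {(0, 2), (1, 3)}, {(1, 2)}]"

text \<open>Vertices \<open>0, \<dots>, 5\<close>, with \<open>k\<close> and \<open>5 - k\<close> antipodal.\<close>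

definition octahedron_V :: "nat set" where
  "octahedron_V = {..<6}"

definition octahedron_E :: "nat set set" where
  "octahedron_E = {{u, v} | u v. u < 6 \<and> v < 6 \<and> u \<noteq> v \<and> u + v \<noteq> 5}"

end

theory Submission
  imports Defs
begin

text \<open>
  Sublattices of finite index correspond to finite quotients because
  \<open>(T \<times> \<int>\<^sup>f) / ({1} \<times> L) \<cong> T \<times> (\<int>\<^sup>f / L)\<close>; in particular the order of a fold is
  the order of \<open>T\<close> times the index of \<open>L\<close>, so that a search by increasing index finds a
  minimal host. The index of the row lattice of a Hermite normal form is its determinant because the
  box spanned by the diagonal is a set of coset representatives; conversely, taking in a lattice, for
  each position, a vector with least positive leading entry there, and reducing these vectors against
  each other, yields a Hermite normal form.

  For the diamond, the row lattice does not depend on the cycle basis: the labels of the vertices are a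
  potential, so every closed walk has crossing vector in \<open>\<int>(1,-1,1)\<close>, and some basis cycle
  must use the edge \<open>{1,2}\<close>, exactly once, since a triangle containing it lies in the cycle space.
  A fold by \<open>L\<close> then passes the check iff \<open>L\<close> avoids the eight vectors listed in
  \<open>diamond_avoids\<close>. If so, the cosets of
  \<open>0, (1,0), (1,1), (2,1), -(1,0), -(1,1)\<close> are distinct, whence the bound \<open>6\<close>.
\<close>

section \<open>Distances and breadth-first search\<close>

text \<open>Two reductions shape the proof. Since \<open>gdist\<close> is an infimum in
  \<open>enat\<close>, distances are handled through bounds
  \<open>gdist V E u v \<le> enat n\<close>, which unfold one edge at a time; breadth-first search
  is then correct because its frontier is the level set at the current depth and levels have no
  gaps. Cosets are compared without working in the quotient: their equality and adjacency are pulled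
  back to membership in the kernel. The diamond has diameter 2, so isometry of a fold only asks
  which labels coincide and which are adjacent. This is a finite list of vectors that must be absent
  from \<open>L\<close>, and no search has to be run on any of the infinitely many lattices. The
  same list yields the lower bound: up to sign, the eight forbidden vectors are exactly the
  differences of the six coset representatives, so avoiding them and separating these six cosets are
  one condition.\<close>

text \<open>Infima in \<open>enat\<close> are attained on nonempty sets; on the empty set the
  infimum is infinite and both sides are false. A bound on the metric thus always comes from an
  actual walk.\<close>

lemma INF_enat_le_iff:
  fixes f :: "'b \<Rightarrow> nat"
  shows "(INF p\<in>A. enat (f p)) \<le> enat n \<longleftrightarrow> (\<exists>p\<in>A. f p \<le> n)"
proof
  assume *: "(INF p\<in>A. enat (f p)) \<le> enat n"
  then have ne: "(\<lambda>p. enat (f p)) ` A \<noteq> {}"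
    by (auto simp: top_enat_def)
  then have "(INF p\<in>A. enat (f p)) \<in> (\<lambda>p. enat (f p)) ` A"
    unfolding Inf_enat_def by (simp only: if_False) (metis (mono_tags, lifting) LeastI_ex ex_in_conv)
  then show "\<exists>p\<in>A. f p \<le> n"
    using * by auto
next
  assume "\<exists>p\<in>A. f p \<le> n"
  then show "(INF p\<in>A. enat (f p)) \<le> enat n"
    by (meson INF_lower2 enat_ord_simps(1))
qed

lemma gdist_le_iff:
  "gdist V E u v \<le> enat n \<longleftrightarrow>
    (\<exists>p. walk V E p \<and> hd p = u \<and> last p = v \<and> length p \<le> Suc n)"
  unfolding gdist_def INF_enat_le_iff by (auto simp: le_diff_conv)

lemma gdist_le_0_iff:
  assumes "u \<in> V"
  shows "gdist V E u v \<le> enat 0 \<longleftrightarrow> u = v"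
proof -
  have *: "walk V E p \<and> length p \<le> Suc 0 \<longleftrightarrow> (\<exists>x\<in>V. p = [x])" for p
    by (cases p) (auto simp: walk_def)
  then have "gdist V E u v \<le> enat 0 \<longleftrightarrow> (\<exists>p. (\<exists>x\<in>V. p = [x]) \<and> hd p = u \<and> last p = v)"
    unfolding gdist_le_iff *[symmetric] by blast
  also have "\<dots> \<longleftrightarrow> u = v"
    using assms by auto
  finally show ?thesis .
qed

text \<open>The disjunct \<open>w = v\<close> absorbs walks that are shorter than the bound allows,
  so the last edge can be split off without a case distinction on lengths.\<close>

lemma gdist_le_Suc_iff:
  assumes "v \<in> V"
  shows "gdist V E u v \<le> enat (Suc n) \<longleftrightarrow>
    (\<exists>w\<in>V. gdist V E u w \<le> enat n \<and> (w = v \<or> {w, v} \<in> E))"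
proof
  assume "gdist V E u v \<le> enat (Suc n)"
  then obtain p where p: "walk V E p" "hd p = u" "last p = v" "length p \<le> Suc (Suc n)"
    unfolding gdist_le_iff by blast
  show "\<exists>w\<in>V. gdist V E u w \<le> enat n \<and> (w = v \<or> {w, v} \<in> E)"
  proof (cases "length p \<le> Suc n")
    case True
    then have "gdist V E u v \<le> enat n"
      unfolding gdist_le_iff using p by blast
    then show ?thesis
      using assms by blast
  next
    case False
    obtain q where q: "p = q @ [v]"
      using p by (cases p rule: rev_cases) (auto simp: walk_def)
    have "q \<noteq> []"
      using False q by auto
    with q have w: "walk V E q" "hd q = u" "length q \<le> Suc n"
      and l: "{last q, v} \<in> E" "last q \<in> V"
      using p by (auto simp: walk_def successively_append_iff)
    have "gdist V E u (last q) \<le> enat n"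
      unfolding gdist_le_iff using w by blast
    then show ?thesis
      using l by blast
  qed
next
  assume "\<exists>w\<in>V. gdist V E u w \<le> enat n \<and> (w = v \<or> {w, v} \<in> E)"
  then obtain w p where w: "w \<in> V" "w = v \<or> {w, v} \<in> E"
    and p: "walk V E p" "hd p = u" "last p = w" "length p \<le> Suc n"
    unfolding gdist_le_iff by blast
  have "walk V E (p @ [v])" if "w \<noteq> v"
    using p w that assms by (auto simp: walk_def successively_append_iff)
  moreover have "hd (p @ [v]) = u"
    using p by (simp add: walk_def)
  moreover have "last (p @ [v]) = v" "length (p @ [v]) \<le> Suc (Suc n)"
    using p by auto
  ultimately show "gdist V E u v \<le> enat (Suc n)"
    unfolding gdist_le_iff using p le_SucI by blast
qed

lemma gdist_le_1_iff:
  assumes "u \<in> V" "v \<in> V"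
  shows "gdist V E u v \<le> enat 1 \<longleftrightarrow> u = v \<or> {u, v} \<in> E"
  using gdist_le_Suc_iff[OF assms(2), of E u 0] gdist_le_0_iff[OF assms(1)] assms by auto

lemma gdist_self [simp]: "u \<in> V \<Longrightarrow> gdist V E u u = 0"
  using gdist_le_0_iff[of u V E u] by (simp flip: zero_enat_def)

lemma gdist_eq_0_iff: "u \<in> V \<Longrightarrow> gdist V E u v = 0 \<longleftrightarrow> u = v"
  using gdist_le_0_iff[of u V E v] by (simp flip: zero_enat_def)

lemma enat_eq_iff_le: "x = enat n \<longleftrightarrow> x \<le> enat n \<and> (\<forall>m<n. \<not> x \<le> enat m)"
  by (cases x) (auto, metis le_neq_implies_less order_refl)

lemma gdist_eq_1_iff:
  assumes "u \<in> V" "v \<in> V"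
  shows "gdist V E u v = 1 \<longleftrightarrow> u \<noteq> v \<and> {u, v} \<in> E"
  unfolding one_enat_def enat_eq_iff_le
  using gdist_le_1_iff[OF assms] gdist_le_0_iff[OF assms(1)] by auto

lemma gdist_eq_2_iff:
  assumes "u \<in> V" "v \<in> V"
  shows "gdist V E u v = 2 \<longleftrightarrow>
    u \<noteq> v \<and> {u, v} \<notin> E \<and> (\<exists>w\<in>V. {u, w} \<in> E \<and> {w, v} \<in> E)"
proof -
  have "(\<forall>m<2. \<not> gdist V E u v \<le> enat m) \<longleftrightarrow> u \<noteq> v \<and> {u, v} \<notin> E"
    using gdist_le_1_iff[OF assms] gdist_le_0_iff[OF assms(1)]
    by (auto simp: less_2_cases_iff)
  moreover have "gdist V E u v \<le> enat 2 \<longleftrightarrow>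
      (\<exists>w\<in>V. (u = w \<or> {u, w} \<in> E) \<and> (w = v \<or> {w, v} \<in> E))"
    unfolding numeral_2_eq_2 gdist_le_Suc_iff[OF assms(2)]
    using gdist_le_1_iff[OF assms(1)] by auto
  ultimately show ?thesis
    unfolding numeral_eq_enat enat_eq_iff_le using assms by auto
qed

lemma gdist_Suc_predecessor:
  assumes "v \<in> V" "gdist V E u v = enat (Suc n)"
  obtains w where "w \<in> V" "gdist V E u w = enat n" "{w, v} \<in> E"
proof -
  obtain w where w: "w \<in> V" "gdist V E u w \<le> enat n" "w = v \<or> {w, v} \<in> E"
    using assms gdist_le_Suc_iff[OF assms(1)] by (metis order_refl)
  then have wv: "w \<noteq> v" using assms by auto
  have "gdist V E u w = enat n"
  proof (rule ccontr)
    assume "gdist V E u w \<noteq> enat n"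
    then obtain m where "gdist V E u w \<le> enat m" "n = Suc m"
      using w(2) by (cases "gdist V E u w"; cases n) auto
    then have "gdist V E u v \<le> enat n"
      using gdist_le_Suc_iff[OF assms(1)] w by blast
    then show False using assms by simp
  qed
  then show ?thesis using that w wv by blast
qed

text \<open>Distances have no gaps: once a level is empty, all later levels are. This justifies
  reporting an infinite distance at the first empty frontier.\<close>

lemma gdist_all_levels:
  assumes "v \<in> V" "gdist V E u v = enat n" "k \<le> n"
  shows "\<exists>w\<in>V. gdist V E u w = enat k"
  using assms
proof (induction n arbitrary: v)
  case (Suc n)
  then show ?case
    by (metis gdist_Suc_predecessor le_Suc_eq)
qed auto

text \<open>\<open>cayley_edges\<close> contains unordered pairs, so an edge may be listed from its
  other endpoint; closure of \<open>S\<close> under inverses reverses such a step.\<close>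

lemma cayley_edge_iff:
  assumes "group \<Gamma>" "S \<subseteq> carrier \<Gamma>" "\<And>s. s \<in> S \<Longrightarrow> inv\<^bsub>\<Gamma>\<^esub> s \<in> S"
    and "x \<in> carrier \<Gamma>" "y \<in> carrier \<Gamma>"
  shows "{x, y} \<in> cayley_edges \<Gamma> S \<longleftrightarrow> (\<exists>s\<in>S. y = x \<otimes>\<^bsub>\<Gamma>\<^esub> s)"
proof -
  interpret group \<Gamma> by fact
  have "x = y \<otimes>\<^bsub>\<Gamma>\<^esub> inv\<^bsub>\<Gamma>\<^esub> s" if "y = x \<otimes>\<^bsub>\<Gamma>\<^esub> s" "s \<in> S" "x \<in> carrier \<Gamma>" for x y s
    using that assms(2) m_assoc r_inv r_one inv_closed by (metis subsetD)
  then have inverse_step: "\<exists>s'\<in>S. x = y \<otimes>\<^bsub>\<Gamma>\<^esub> s'" if "y = x \<otimes>\<^bsub>\<Gamma>\<^esub> s" "s \<in> S" "x \<in> carrier \<Gamma>" for x y s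
    using that assms(3) by meson
  show ?thesis
  proof
    assume "{x, y} \<in> cayley_edges \<Gamma> S"
    then obtain h s where hs: "{x, y} = {h, h \<otimes>\<^bsub>\<Gamma>\<^esub> s}" "h \<in> carrier \<Gamma>" "s \<in> S"
      unfolding cayley_edges_def by blast
    then consider "x = h" "y = x \<otimes>\<^bsub>\<Gamma>\<^esub> s" | "y = h" "x = y \<otimes>\<^bsub>\<Gamma>\<^esub> s"
      by (metis doubleton_eq_iff)
    then show "\<exists>s\<in>S. y = x \<otimes>\<^bsub>\<Gamma>\<^esub> s"
      using inverse_step hs by cases auto
  next
    assume "\<exists>s\<in>S. y = x \<otimes>\<^bsub>\<Gamma>\<^esub> s"
    then show "{x, y} \<in> cayley_edges \<Gamma> S"
      unfolding cayley_edges_def using assms(4) by blast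
  qed
qed

text \<open>The last conjunct serves the exit with an empty frontier: a finite distance of
  \<open>y\<close> would be at least \<open>k\<close>, and then level \<open>k\<close> would be
  inhabited.\<close>

definition bfs_invariant :: "'b set \<Rightarrow> 'b set set \<Rightarrow> 'b \<Rightarrow> 'b \<Rightarrow> nat \<times> 'b set \<times> 'b set \<Rightarrow> bool" where
  "bfs_invariant V E x y = (\<lambda>(k, vis, fr).
     vis = {h \<in> V. gdist V E x h \<le> enat k} \<and>
     fr = {h \<in> V. gdist V E x h = enat k} \<and>
     (\<forall>j<k. gdist V E x y \<noteq> enat j))"

lemma bfs_step_invariant:
  assumes G: "group \<Gamma>" "S \<subseteq> carrier \<Gamma>" "\<And>s. s \<in> S \<Longrightarrow> inv\<^bsub>\<Gamma>\<^esub> s \<in> S"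
    and y: "y \<in> carrier \<Gamma>"
    and inv: "bfs_invariant (carrier \<Gamma>) (cayley_edges \<Gamma> S) x y (k, vis, fr)"
    and "y \<notin> fr"
  shows "bfs_invariant (carrier \<Gamma>) (cayley_edges \<Gamma> S) x y (bfs_step \<Gamma> S (k, vis, fr))"
proof -
  interpret group \<Gamma> by fact
  let ?V = "carrier \<Gamma>" and ?E = "cayley_edges \<Gamma> S"
  let ?d = "gdist ?V ?E x"
  have vis: "vis = {h \<in> ?V. ?d h \<le> enat k}" and fr: "fr = {h \<in> ?V. ?d h = enat k}"
    and *: "\<forall>j<k. ?d y \<noteq> enat j"
    using inv by (auto simp: bfs_invariant_def)
  define new where "new = {h \<otimes>\<^bsub>\<Gamma>\<^esub> s | h s. h \<in> fr \<and> s \<in> S} - vis"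
  have step: "v \<in> new \<longleftrightarrow> v \<in> ?V \<and> v \<notin> vis \<and> (\<exists>h\<in>fr. {h, v} \<in> ?E)" for v
  proof
    assume "v \<in> new"
    then obtain h s where hs: "h \<in> fr" "s \<in> S" "v = h \<otimes>\<^bsub>\<Gamma>\<^esub> s" "v \<notin> vis"
      unfolding new_def by blast
    then have "h \<in> ?V" "v \<in> ?V"
      using fr G by auto
    then show "v \<in> ?V \<and> v \<notin> vis \<and> (\<exists>h\<in>fr. {h, v} \<in> ?E)"
      using hs cayley_edge_iff[OF G] by blast
  next
    assume a: "v \<in> ?V \<and> v \<notin> vis \<and> (\<exists>h\<in>fr. {h, v} \<in> ?E)"
    then obtain h where h: "h \<in> fr" "{h, v} \<in> ?E" by blast
    then have "h \<in> ?V" using fr by simp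
    then obtain s where "s \<in> S" "v = h \<otimes>\<^bsub>\<Gamma>\<^esub> s"
      using cayley_edge_iff[OF G, of h v] h a by blast
    then show "v \<in> new"
      using a h unfolding new_def by blast
  qed
  have new: "new = {h \<in> ?V. ?d h = enat (Suc k)}"
  proof (intro Set.set_eqI iffI)
    fix v assume "v \<in> new"
    then obtain h where v: "v \<in> ?V" "\<not> ?d v \<le> enat k" "h \<in> ?V" "?d h = enat k" "{h, v} \<in> ?E"
      using step vis fr by auto
    then have "?d v \<le> enat (Suc k)"
      using gdist_le_Suc_iff[OF v(1)] by (metis order_refl)
    with v show "v \<in> {h \<in> ?V. ?d h = enat (Suc k)}"
      by (cases "?d v") auto
  next
    fix v assume "v \<in> {h \<in> ?V. ?d h = enat (Suc k)}"
    then have v: "v \<in> ?V" "?d v = enat (Suc k)" by auto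
    obtain h where "h \<in> ?V" "?d h = enat k" "{h, v} \<in> ?E"
      using gdist_Suc_predecessor[OF v] .
    then show "v \<in> new"
      using v step vis fr by auto
  qed
  have "vis \<union> new = {h \<in> ?V. ?d h \<le> enat (Suc k)}"
  proof -
    have "e \<le> enat (Suc k) \<longleftrightarrow> e \<le> enat k \<or> e = enat (Suc k)" for e
      by (cases e) auto
    then show ?thesis unfolding vis new by auto
  qed
  moreover have "\<forall>j<Suc k. ?d y \<noteq> enat j"
    using * \<open>y \<notin> fr\<close> fr y by (auto simp: less_Suc_eq)
  ultimately show ?thesis
    unfolding bfs_invariant_def bfs_step_def using new by (simp add: new_def Let_def)
qed

lemma bfs_dist_eq_gdist:
  assumes G: "group \<Gamma>" "S \<subseteq> carrier \<Gamma>" "\<And>s. s \<in> S \<Longrightarrow> inv\<^bsub>\<Gamma>\<^esub> s \<in> S"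
    and fin: "finite (carrier \<Gamma>)"
    and x: "x \<in> carrier \<Gamma>" and y: "y \<in> carrier \<Gamma>"
  shows "bfs_dist \<Gamma> S x y = gdist (carrier \<Gamma>) (cayley_edges \<Gamma> S) x y"
proof -
  let ?V = "carrier \<Gamma>" and ?E = "cayley_edges \<Gamma> S"
  let ?b = "\<lambda>(k :: nat, vis :: 'a set, fr). y \<notin> fr \<and> fr \<noteq> {}"
  let ?I = "bfs_invariant ?V ?E x y"
  \<comment> \<open>The last step may discover nothing and leave the number of unvisited elements
    unchanged; the extra 1 for a nonempty frontier makes that step decrease as well.\<close>
  let ?\<mu> = "\<lambda>(k :: nat, vis, fr). card (?V - vis) + (if fr = {} then 0 else 1)"
  have init: "?I (0, {x}, {x})"
    using x by (auto simp: bfs_invariant_def gdist_le_0_iff gdist_eq_0_iff enat_0)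
  have step: "?I (bfs_step \<Gamma> S s)" if "?I s" "?b s" for s
  proof -
    obtain k vis fr where s: "s = (k, vis, fr)" by (cases s)
    then have "y \<notin> fr" using that(2) by simp
    then show ?thesis
      using bfs_step_invariant[OF G y] that(1) unfolding s by blast
  qed
  have decr: "?\<mu> (bfs_step \<Gamma> S s) < ?\<mu> s" if I: "?I s" "?b s" for s
  proof -
    obtain k vis fr where s: "s = (k, vis, fr)" by (cases s)
    define new where "new = {h \<otimes>\<^bsub>\<Gamma>\<^esub> s | h s. h \<in> fr \<and> s \<in> S} - vis"
    have st: "bfs_step \<Gamma> S (k, vis, fr) = (Suc k, vis \<union> new, new)"
      by (simp add: bfs_step_def new_def Let_def)
    have "new \<subseteq> ?V"
      using step[OF I] unfolding s st by (auto simp: bfs_invariant_def)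
    then have "new \<noteq> {} \<Longrightarrow> card (?V - (vis \<union> new)) < card (?V - vis)"
      using fin by (intro psubset_card_mono) (auto simp: new_def)
    moreover have "fr \<noteq> {}" using I s by auto
    ultimately show ?thesis
      unfolding s st by auto
  qed
  obtain t where t: "while_option ?b (bfs_step \<Gamma> S) (0, {x}, {x}) = Some t"
    using measure_while_option_Some[of ?I ?b "bfs_step \<Gamma> S" ?\<mu>, OF _ init] step decr by blast
  have It: "?I t"
    using while_option_rule[of ?I ?b "bfs_step \<Gamma> S", OF step t init] by blast
  have stop: "\<not> ?b t"
    using while_option_stop[OF t] .
  obtain k vis fr where tt: "t = (k, vis, fr)" by (cases t)
  show ?thesis
  proof (cases "y \<in> fr")
    case True
    then show ?thesis
      using It unfolding bfs_dist_def t tt by (auto simp: bfs_invariant_def)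
  next
    case False
    then have fr: "fr = {}" using stop tt by auto
    have "gdist ?V ?E x y \<noteq> enat n" for n
    proof
      assume n: "gdist ?V ?E x y = enat n"
      then have "k \<le> n"
        using It tt by (auto simp: bfs_invariant_def intro: leI)
      then show False
        using gdist_all_levels[OF y n] It fr tt by (auto simp: bfs_invariant_def)
    qed
    then have "gdist ?V ?E x y = \<infinity>" by auto
    then show ?thesis
      using fr unfolding bfs_dist_def t tt by simp
  qed
qed

section \<open>Cosets, labelled embeddings and adjacency in a quotient\<close>

lemma (in group) rcos_eq_iff:
  assumes "subgroup H G" "x \<in> carrier G" "y \<in> carrier G"
  shows "H #> x = H #> y \<longleftrightarrow> x \<otimes> inv y \<in> H"
proof -
  interpret subgroup H G by fact
  have "H #> x = H #> y \<longleftrightarrow> x \<in> H #> y"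
    using assms repr_independence repr_independenceD by metis
  then show ?thesis
    using rcos_module assms(2,3) is_group by blast
qed

text \<open>Collects the closure conditions under which the distance results apply to the universal
  embedding and to all of its quotients alike.\<close>

definition labelled_in_comm_group :: "'a set \<Rightarrow> ('a, 'b) embedding \<Rightarrow> bool" where
  "labelled_in_comm_group V X \<longleftrightarrow>
     comm_group (host X) \<and> set (gens X) \<subseteq> carrier (host X) \<and> lab X ` V \<subseteq> carrier (host X)"

lemma connection_set_closed:
  assumes "labelled_in_comm_group V X"
  shows "connection_set X \<subseteq> carrier (host X)"
    and "s \<in> connection_set X \<Longrightarrow> inv\<^bsub>host X\<^esub> s \<in> connection_set X"
proof -
  interpret comm_group "host X"
    using assms by (simp add: labelled_in_comm_group_def)
  have g: "set (gens X) \<subseteq> carrier (host X)"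
    using assms by (simp add: labelled_in_comm_group_def)
  show "connection_set X \<subseteq> carrier (host X)"
    using g by (auto simp: connection_set_def)
  show "inv\<^bsub>host X\<^esub> s \<in> connection_set X" if "s \<in> connection_set X"
    using that g unfolding connection_set_def
    by (auto simp: subset_iff)
qed

lemma labelled_quotient:
  assumes "labelled_in_comm_group V X" "subgroup H (host X)"
  shows "labelled_in_comm_group V (quotient_embedding X H)"
proof -
  interpret comm_group "host X"
    using assms by (simp add: labelled_in_comm_group_def)
  show ?thesis
    using assms abelian_FactGroup[of H]
    by (auto simp: labelled_in_comm_group_def quotient_embedding_def carrier_FactGroup)
qed

lemma connection_set_quotient:
  assumes X: "labelled_in_comm_group V X" and H: "subgroup H (host X)"
  shows "connection_set (quotient_embedding X H) =
    (\<lambda>z. H #>\<^bsub>host X\<^esub> z) ` (set (gens X) \<union> m_inv (host X) ` set (gens X)) - {H}"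
proof -
  interpret comm_group "host X"
    using X by (simp add: labelled_in_comm_group_def)
  interpret H: normal H "host X"
    using H by (rule subgroup_imp_normal)
  have "inv\<^bsub>host X Mod H\<^esub> (H #>\<^bsub>host X\<^esub> g) = H #>\<^bsub>host X\<^esub> (inv\<^bsub>host X\<^esub> g)" if "g \<in> set (gens X)" for g
    using that X by (auto simp: H.inv_FactGroup H.rcos_inv carrier_FactGroup labelled_in_comm_group_def)
  then show ?thesis
    by (auto simp: connection_set_def quotient_embedding_def image_iff)
qed

text \<open>Pulls adjacency of cosets back to membership of elements in \<open>H\<close>, so that
  folds can be tested by lattice membership instead of computation in the quotient. The first
  conjunct is what remains of deleting the identity from the connection set.\<close>

lemma cayley_edge_quotient_iff:
  assumes X: "labelled_in_comm_group V X" and H: "subgroup H (host X)"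
    and x: "x \<in> carrier (host X)" and y: "y \<in> carrier (host X)"
  shows "{H #>\<^bsub>host X\<^esub> x, H #>\<^bsub>host X\<^esub> y}
      \<in> cayley_edges (host X Mod H) (connection_set (quotient_embedding X H)) \<longleftrightarrow>
    y \<otimes>\<^bsub>host X\<^esub> inv\<^bsub>host X\<^esub> x \<notin> H \<and>
    (\<exists>g\<in>set (gens X). y \<otimes>\<^bsub>host X\<^esub> inv\<^bsub>host X\<^esub> x \<otimes>\<^bsub>host X\<^esub> g \<in> H \<or>
      y \<otimes>\<^bsub>host X\<^esub> inv\<^bsub>host X\<^esub> x \<otimes>\<^bsub>host X\<^esub> inv\<^bsub>host X\<^esub> g \<in> H)"
proof -
  interpret comm_group "host X"
    using X by (simp add: labelled_in_comm_group_def)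
  interpret H: normal H "host X"
    using H by (rule subgroup_imp_normal)
  interpret Q: group "host X Mod H"
    by (rule H.factorgroup_is_group)
  let ?c = "\<lambda>x. H #>\<^bsub>host X\<^esub> x" and ?S = "connection_set (quotient_embedding X H)"
  have g: "g \<in> carrier (host X)" if "g \<in> set (gens X)" for g
    using X that by (auto simp: labelled_in_comm_group_def)
  have host: "host (quotient_embedding X H) = host X Mod H"
    by (simp add: quotient_embedding_def)
  have c: "?c z \<in> carrier (host X Mod H)" if "z \<in> carrier (host X)" for z
    using that by (auto simp: carrier_FactGroup)
  note S = connection_set_quotient[OF X H]
  \<comment> \<open>If \<open>z\<close> leads from the coset of \<open>x\<close> to that of
    \<open>y\<close>, then \<open>z\<close> is trivial in the quotient exactly when the two cosets
    agree. The nontriviality condition therefore no longer depends on \<open>z\<close> and can be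
    moved out of the existential.\<close>
  have step: "?c y = ?c x \<otimes>\<^bsub>host X Mod H\<^esub> ?c z \<and> ?c z \<noteq> H \<longleftrightarrow>
      y \<otimes>\<^bsub>host X\<^esub> inv\<^bsub>host X\<^esub> x \<notin> H \<and> y \<otimes>\<^bsub>host X\<^esub> inv\<^bsub>host X\<^esub> x \<otimes>\<^bsub>host X\<^esub> inv\<^bsub>host X\<^esub> z \<in> H"
    if z: "z \<in> carrier (host X)" for z
  proof -
    have "?c y = ?c x \<otimes>\<^bsub>host X Mod H\<^esub> ?c z \<longleftrightarrow>
        y \<otimes>\<^bsub>host X\<^esub> inv\<^bsub>host X\<^esub> x \<otimes>\<^bsub>host X\<^esub> inv\<^bsub>host X\<^esub> z \<in> H"
      using rcos_eq_iff[OF H y, of "x \<otimes>\<^bsub>host X\<^esub> z"] x y z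
      by (simp add: H.rcos_sum inv_mult m_assoc)
    moreover have "?c z = H \<longleftrightarrow> ?c y = ?c x" if "?c y = ?c x \<otimes>\<^bsub>host X Mod H\<^esub> ?c z"
      using that Q.r_cancel_one'[OF c[OF x] c[OF z]] Q.l_cancel_one'[OF c[OF x] c[OF z]]
      by (metis one_FactGroup)
    ultimately show ?thesis
      using rcos_eq_iff[OF H y x] by blast
  qed
  have "{?c x, ?c y} \<in> cayley_edges (host X Mod H) ?S \<longleftrightarrow>
      (\<exists>s\<in>?S. ?c y = ?c x \<otimes>\<^bsub>host X Mod H\<^esub> s)"
    using cayley_edge_iff[OF Q.is_group] connection_set_closed[OF labelled_quotient[OF X H]]
      c x y by (simp add: host)
  also have "\<dots> \<longleftrightarrow> (\<exists>z\<in>set (gens X) \<union> m_inv (host X) ` set (gens X).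
      ?c y = ?c x \<otimes>\<^bsub>host X Mod H\<^esub> ?c z \<and> ?c z \<noteq> H)"
    unfolding S by blast
  also have "\<dots> \<longleftrightarrow> (\<exists>z\<in>set (gens X) \<union> m_inv (host X) ` set (gens X).
      y \<otimes>\<^bsub>host X\<^esub> inv\<^bsub>host X\<^esub> x \<notin> H \<and> y \<otimes>\<^bsub>host X\<^esub> inv\<^bsub>host X\<^esub> x \<otimes>\<^bsub>host X\<^esub> inv\<^bsub>host X\<^esub> z \<in> H)"
    using step g by (intro bex_cong) auto
  also have "\<dots> \<longleftrightarrow> y \<otimes>\<^bsub>host X\<^esub> inv\<^bsub>host X\<^esub> x \<notin> H \<and>
    (\<exists>g\<in>set (gens X). y \<otimes>\<^bsub>host X\<^esub> inv\<^bsub>host X\<^esub> x \<otimes>\<^bsub>host X\<^esub> g \<in> H \<or>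
      y \<otimes>\<^bsub>host X\<^esub> inv\<^bsub>host X\<^esub> x \<otimes>\<^bsub>host X\<^esub> inv\<^bsub>host X\<^esub> g \<in> H)"
    using g by (auto simp: bex_Un)
  finally show ?thesis .
qed

text \<open>The check compares distinct vertices only, but for equal vertices both distances are 0.
  Injectivity comes for free: equal labels are at distance 0, whereas distinct vertices are
  not.\<close>

lemma passes_exact_check_iff_isometric:
  assumes "finite_connected_graph V E" "labelled_in_comm_group V X" "finite (carrier (host X))"
  shows "passes_exact_check V E X \<longleftrightarrow> isometric V E X"
proof -
  interpret comm_group "host X"
    using assms by (simp add: labelled_in_comm_group_def)
  let ?d = "gdist (carrier (host X)) (cayley_edges (host X) (connection_set X))"
  have lab: "lab X u \<in> carrier (host X)" if "u \<in> V" for u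
    using assms that by (auto simp: labelled_in_comm_group_def)
  have bfs: "bfs_dist (host X) (connection_set X) (lab X u) (lab X v) = ?d (lab X u) (lab X v)"
    if "u \<in> V" "v \<in> V" for u v
    using bfs_dist_eq_gdist[OF is_group connection_set_closed[OF assms(2)] assms(3)] lab that by blast
  show ?thesis
  proof
    assume P: "passes_exact_check V E X"
    have d: "?d (lab X u) (lab X v) = gdist V E u v" if "u \<in> V" "v \<in> V" for u v
      using P bfs[OF that] that lab unfolding passes_exact_check_def
      by (cases "u = v") auto
    then have "inj_on (lab X) V"
      by (metis (no_types, lifting) gdist_eq_0_iff gdist_self inj_onI)
    with d show "isometric V E X"
      by (simp add: isometric_def)
  next
    assume "isometric V E X"
    then show "passes_exact_check V E X"
      using bfs by (simp add: isometric_def passes_exact_check_def)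
  qed
qed

section \<open>Well-definedness of the universal embedding\<close>

lemma comm_group_univ_group: "comm_group (univ_group Fs Bs)"
  and univ_gen_closed: "j < length Fs \<Longrightarrow> univ_gen Fs Bs j \<in> carrier (univ_group Fs Bs)"
proof -
  let ?A = "cycle_class_matrix Fs Bs"
  interpret comm_group "Zvec (length Fs)" by (rule comm_group_vec)
  have "row_lattice ?A = generate (Zvec (length Fs)) (set (rows ?A))"
    by (simp add: row_lattice_def cycle_class_matrix_def)
  moreover have "set (rows ?A) \<subseteq> carrier (Zvec (length Fs))"
    using rows_carrier[of ?A] by (simp add: cycle_class_matrix_def monoid_vec_simps)
  ultimately have "subgroup (row_lattice ?A) (Zvec (length Fs))"
    by (simp add: generate_is_subgroup)
  then show "comm_group (univ_group Fs Bs)"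
    unfolding univ_group_def by (rule abelian_FactGroup)
  show "univ_gen Fs Bs j \<in> carrier (univ_group Fs Bs)" if "j < length Fs"
    using that by (auto simp: univ_gen_def univ_group_def carrier_FactGroup monoid_vec_simps)
qed

lemma oriented_partition_class:
  assumes "oriented_partition E Fs" "a \<in> \<Union>(set Fs)"
  shows "\<exists>!j. j < length Fs \<and> a \<in> Fs ! j"
proof -
  obtain j where "j < length Fs" "a \<in> Fs ! j"
    using assms(2) by (metis UnionE in_set_conv_nth)
  then show ?thesis
    using assms(1) unfolding oriented_partition_def by blast
qed

lemma signed_gen_closed:
  assumes "oriented_partition E Fs" "{u, v} \<in> E"
  shows "signed_gen Fs Bs (u, v) \<in> carrier (univ_group Fs Bs)"
proof -
  interpret comm_group "univ_group Fs Bs" by (rule comm_group_univ_group)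
  have "{u, v} \<in> edge_of ` \<Union>(set Fs)"
    using assms unfolding oriented_partition_def bij_betw_def by blast
  then have "(u, v) \<in> \<Union>(set Fs) \<or> (v, u) \<in> \<Union>(set Fs)"
    by (force simp: edge_of_def doubleton_eq_iff)
  moreover have "univ_gen Fs Bs (THE j. j < length Fs \<and> a \<in> Fs ! j) \<in> carrier (univ_group Fs Bs)"
    if "a \<in> \<Union>(set Fs)" for a
    using theI'[OF oriented_partition_class[OF assms(1) that]] univ_gen_closed by blast
  ultimately show ?thesis
    unfolding signed_gen_def by auto
qed

lemma walk_Cons_Cons:
  "walk V E (x # y # p) \<longleftrightarrow> x \<in> V \<and> {x, y} \<in> E \<and> walk V E (y # p)"
  by (auto simp: walk_def)

lemma steps_Cons_Cons: "steps (x # y # p) = (x, y) # steps (y # p)"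
  by (simp add: steps_def)

lemma steps_singleton: "steps [x] = []"
  by (simp add: steps_def)

lemma path_sum_closed:
  assumes "oriented_partition E Fs" "walk V E p"
  shows "path_sum Fs Bs p \<in> carrier (univ_group Fs Bs)"
proof -
  interpret comm_group "univ_group Fs Bs" by (rule comm_group_univ_group)
  show ?thesis
    using assms(2)
  proof (induction p rule: induct_list012)
    case (3 x y p)
    then show ?case
      using signed_gen_closed[OF assms(1), of x y Bs]
      by (simp add: walk_Cons_Cons path_sum_def steps_Cons_Cons)
  qed (simp_all add: path_sum_def steps_def walk_def)
qed

lemma labelled_universal_embedding:
  assumes "oriented_partition E Fs" "root_paths V E r P"
  shows "labelled_in_comm_group V (universal_embedding Fs Bs P)"
  using assms comm_group_univ_group univ_gen_closed path_sum_closed[OF assms(1), of V _ Bs]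
  by (auto simp: labelled_in_comm_group_def universal_embedding_def root_paths_def path_between_def)

section \<open>Folds and finite quotients\<close>

text \<open>\<open>T\<close> and the splitting \<open>\<psi>\<close> are parameters instead of being
  extracted from a Smith normal form, so the results hold for every such identification of the
  host.\<close>

locale free_part_decomposition =
  G: comm_group "host X" + T: comm_group T
  for X :: "('a, 'b) embedding" and T :: "'t monoid" +
  fixes f :: nat and \<psi>
  assumes iso: "\<psi> \<in> iso (host X) (T \<times>\<times> Zvec f)"
begin

sublocale Z: comm_group "Zvec f"
  by (rule comm_group_vec)

sublocale TZ: group "T \<times>\<times> Zvec f"
  by (rule DirProd_group) unfold_locales

sublocale \<psi>: group_hom "host X" "T \<times>\<times> Zvec f" \<psi>
  using iso by unfold_locales (auto simp: iso_def)

lemma bij: "bij_betw \<psi> (carrier (host X)) (carrier T \<times> carrier (Zvec f))"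
  using iso by (simp add: iso_def)

abbreviation "K \<equiv> fold_kernel X T \<psi>"

text \<open>\<open>\<psi>\<close> is onto, so projecting the image of \<open>K L\<close> to the
  second factor returns \<open>L\<close>.\<close>

lemma fold_kernel_inj:
  assumes "L \<subseteq> carrier (Zvec f)" "L' \<subseteq> carrier (Zvec f)" "K L = K L'"
  shows "L = L'"
proof -
  have "(\<lambda>x. snd (\<psi> x)) ` K L = L" if "L \<subseteq> carrier (Zvec f)" for L
  proof
    show "(\<lambda>x. snd (\<psi> x)) ` K L \<subseteq> L"
      by (auto simp: fold_kernel_def)
    show "L \<subseteq> (\<lambda>x. snd (\<psi> x)) ` K L"
    proof
      fix l assume "l \<in> L"
      then have "(\<one>\<^bsub>T\<^esub>, l) \<in> \<psi> ` carrier (host X)"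
        using bij that by (auto simp: bij_betw_def)
      then obtain x where "x \<in> carrier (host X)" "\<psi> x = (\<one>\<^bsub>T\<^esub>, l)"
        by force
      then show "l \<in> (\<lambda>x. snd (\<psi> x)) ` K L"
        using \<open>l \<in> L\<close> by (force simp: fold_kernel_def)
    qed
  qed
  then show ?thesis using assms by metis
qed

context
  fixes L assumes L: "subgroup L (Zvec f)"
begin

text \<open>This map is onto with kernel \<open>K L\<close>. The first isomorphism theorem then
  gives the structure of the fold, and that \<open>K L\<close> is a subgroup, in one go.\<close>

lemma fold_hom:
  "(\<lambda>x. (fst (\<psi> x), L #>\<^bsub>Zvec f\<^esub> snd (\<psi> x))) \<in> hom (host X) (T \<times>\<times> (Zvec f Mod L))"
proof -
  interpret L: normal L "Zvec f"
    using L by (rule Z.subgroup_imp_normal)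
  have "fst \<circ> \<psi> \<in> hom (host X) T" "snd \<circ> \<psi> \<in> hom (host X) (Zvec f)"
    using \<psi>.homh by (simp_all add: hom_pairwise)
  moreover from this(2) have "(\<lambda>a. L #>\<^bsub>Zvec f\<^esub> a) \<circ> (snd \<circ> \<psi>) \<in> hom (host X) (Zvec f Mod L)"
    using L.r_coset_hom_Mod hom_compose by blast
  ultimately show ?thesis
    by (simp add: hom_paired comp_def)
qed

lemma fold_kernel_eq_kernel:
  "kernel (host X) (T \<times>\<times> (Zvec f Mod L)) (\<lambda>x. (fst (\<psi> x), L #>\<^bsub>Zvec f\<^esub> snd (\<psi> x))) = K L"
proof -
  have "L #>\<^bsub>Zvec f\<^esub> snd (\<psi> x) = L \<longleftrightarrow> snd (\<psi> x) \<in> L" if "x \<in> carrier (host X)" for x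
  proof -
    have "snd (\<psi> x) \<in> carrier (Zvec f)"
      using \<psi>.hom_closed[OF that] by (auto simp: carrier_DirProd)
    then show ?thesis
      using Z.coset_join1 Z.coset_join2 L by blast
  qed
  then show ?thesis
    by (auto simp: kernel_def fold_kernel_def mem_Times_iff)
qed

lemma fold_iso:
  "host X Mod K L \<cong> T \<times>\<times> (Zvec f Mod L)"
  and subgroup_fold_kernel: "subgroup (K L) (host X)"
proof -
  let ?h = "\<lambda>x. (fst (\<psi> x), L #>\<^bsub>Zvec f\<^esub> snd (\<psi> x))"
  interpret L: normal L "Zvec f"
    using L by (rule Z.subgroup_imp_normal)
  interpret ZL: group "Zvec f Mod L"
    by (rule L.factorgroup_is_group)
  interpret Q: group "T \<times>\<times> (Zvec f Mod L)"
    by (rule DirProd_group) unfold_locales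
  interpret h: group_hom "host X" "T \<times>\<times> (Zvec f Mod L)" ?h
    using fold_hom by unfold_locales
  have "?h ` carrier (host X) = (\<lambda>p. (fst p, L #>\<^bsub>Zvec f\<^esub> snd p)) ` \<psi> ` carrier (host X)"
    by (simp add: image_image)
  also have "\<psi> ` carrier (host X) = carrier T \<times> carrier (Zvec f)"
    using bij by (simp add: bij_betw_def)
  finally have "?h ` carrier (host X) = carrier (T \<times>\<times> (Zvec f Mod L))"
    by (auto simp: carrier_FactGroup image_iff)
  then show "host X Mod K L \<cong> T \<times>\<times> (Zvec f Mod L)"
    using h.FactGroup_iso fold_kernel_eq_kernel by simp
  show "subgroup (K L) (host X)"
    using h.subgroup_kernel fold_kernel_eq_kernel by simp
qed

lemma finite_fold_iff:
  assumes "finite (carrier T)"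
  shows "finite (carrier (host X Mod K L)) \<longleftrightarrow> finite (rcosets\<^bsub>Zvec f\<^esub> L)"
proof -
  have "finite (carrier (host X Mod K L)) \<longleftrightarrow> finite (carrier T \<times> (rcosets\<^bsub>Zvec f\<^esub> L))"
    using fold_iso bij_betw_finite unfolding is_iso_def iso_def
    by (fastforce simp: FactGroup_def)
  then show ?thesis
    using assms T.one_closed by (metis empty_iff finite_SigmaI finite_cartesian_productD2)
qed

lemma order_fold:
  "order (host X Mod K L) = order T * lattice_index f L"
proof -
  have "card (carrier (host X Mod K L)) = card (carrier T \<times> (rcosets\<^bsub>Zvec f\<^esub> L))"
    using fold_iso bij_betw_same_card unfolding is_iso_def iso_def
    by (fastforce simp: FactGroup_def)
  then show ?thesis
    by (simp add: order_def lattice_index_def card_cartesian_product)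
qed

end

text \<open>Elements of the free part have trivial \<open>T\<close>-coordinate, so
  \<open>snd \<circ> \<psi>\<close> is injective there and \<open>H\<close> can be recovered from
  its image, which serves as \<open>L\<close>.\<close>

lemma subgroup_of_free_part:
  assumes H: "subgroup H (host X)" "H \<subseteq> free_part X T f \<psi>"
  obtains L where "subgroup L (Zvec f)" "H = K L"
proof
  interpret H: subgroup H "host X" by fact
  have snd: "snd \<circ> \<psi> \<in> hom (host X) (Zvec f)"
    using \<psi>.homh by (simp add: hom_pairwise)
  interpret s: group_hom "host X" "Zvec f" "snd \<circ> \<psi>"
    using snd by unfold_locales
  show "subgroup ((snd \<circ> \<psi>) ` H) (Zvec f)"
    using s.subgroup_img_is_subgroup H by blast
  have Hp: "x \<in> carrier (host X) \<and> fst (\<psi> x) = \<one>\<^bsub>T\<^esub>" if "x \<in> H" for x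
    using H(2) that by (auto simp: free_part_def fold_kernel_def mem_Times_iff)
  show "H = K ((snd \<circ> \<psi>) ` H)"
  proof
    show "H \<subseteq> K ((snd \<circ> \<psi>) ` H)"
      using Hp by (auto simp: fold_kernel_def mem_Times_iff)
    show "K ((snd \<circ> \<psi>) ` H) \<subseteq> H"
    proof
      fix x assume "x \<in> K ((snd \<circ> \<psi>) ` H)"
      then obtain h where "x \<in> carrier (host X)" "fst (\<psi> x) = \<one>\<^bsub>T\<^esub>" "h \<in> H" "snd (\<psi> x) = snd (\<psi> h)"
        by (auto simp: fold_kernel_def mem_Times_iff)
      then have "x = h"
        using bij Hp by (metis bij_betw_def inj_onD prod_eqI)
      then show "x \<in> H" using \<open>h \<in> H\<close> by simp
    qed
  qed
qed

lemma fold_passes_iff: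
  assumes "finite_connected_graph V E" "labelled_in_comm_group V X"
    and "finite (carrier T)" "finite_index_sublattice f L"
  shows "passes_exact_check V E (fold_by X T \<psi> L) \<longleftrightarrow> isometric_finite_quotient V E X (K L)"
proof -
  have L: "subgroup L (Zvec f)" "finite (rcosets\<^bsub>Zvec f\<^esub> L)"
    using assms by (simp_all add: finite_index_sublattice_def)
  have fin: "finite (carrier (host X Mod K L))"
    using finite_fold_iff[OF L(1)] L assms by blast
  then have "passes_exact_check V E (fold_by X T \<psi> L) \<longleftrightarrow> isometric V E (fold_by X T \<psi> L)"
    unfolding fold_by_def
    by (intro passes_exact_check_iff_isometric labelled_quotient subgroup_fold_kernel assms L)
      (simp add: quotient_embedding_def)
  then show ?thesis
    using fin subgroup_fold_kernel[OF L(1)]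
    by (simp add: isometric_finite_quotient_def fold_by_def)
qed

theorem bij_betw_folds_quotients:
  assumes "finite_connected_graph V E" "labelled_in_comm_group V X" "finite (carrier T)"
  shows "bij_betw K {L. finite_index_sublattice f L \<and> passes_exact_check V E (fold_by X T \<psi> L)}
    {H. isometric_finite_quotient V E X H \<and> H \<subseteq> free_part X T f \<psi>}"
  unfolding bij_betw_def
proof
  show "inj_on K {L. finite_index_sublattice f L \<and> passes_exact_check V E (fold_by X T \<psi> L)}"
    using fold_kernel_inj
    by (intro inj_onI) (auto simp: finite_index_sublattice_def subgroup.subset)
  show "K ` {L. finite_index_sublattice f L \<and> passes_exact_check V E (fold_by X T \<psi> L)} =
    {H. isometric_finite_quotient V E X H \<and> H \<subseteq> free_part X T f \<psi>}"
  proof (intro subset_antisym image_subsetI subsetI CollectI)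
    fix L assume "L \<in> {L. finite_index_sublattice f L \<and> passes_exact_check V E (fold_by X T \<psi> L)}"
    moreover from this have "L \<subseteq> carrier (Zvec f)"
      by (auto simp: finite_index_sublattice_def dest: subgroup.subset)
    then have "K L \<subseteq> free_part X T f \<psi>"
      by (auto simp: free_part_def fold_kernel_def)
    ultimately show "isometric_finite_quotient V E X (K L) \<and> K L \<subseteq> free_part X T f \<psi>"
      using fold_passes_iff assms by blast
  next
    fix H assume "H \<in> {H. isometric_finite_quotient V E X H \<and> H \<subseteq> free_part X T f \<psi>}"
    then have H: "isometric_finite_quotient V E X H" "H \<subseteq> free_part X T f \<psi>" by auto
    then obtain L where L: "subgroup L (Zvec f)" "H = K L"
      using subgroup_of_free_part[of H] by (auto simp: isometric_finite_quotient_def)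
    then have "finite_index_sublattice f L"
      using finite_fold_iff[OF L(1)] assms H
      by (auto simp: isometric_finite_quotient_def finite_index_sublattice_def)
    then show "H \<in> K ` {L. finite_index_sublattice f L \<and> passes_exact_check V E (fold_by X T \<psi> L)}"
      using fold_passes_iff assms H L by blast
  qed
qed

lemma free_part_eq_carrier:
  assumes "carrier T = {\<one>\<^bsub>T\<^esub>}"
  shows "free_part X T f \<psi> = carrier (host X)"
  using \<psi>.hom_closed assms by (auto simp: free_part_def fold_kernel_def)

end

section \<open>Hermite normal forms and lattice index\<close>

lemma group_Zvec: "group (Zvec f)"
  using comm_group_vec comm_group.axioms(2) by blast

lemma inv_Zvec: "x \<in> carrier_vec f \<Longrightarrow> inv\<^bsub>Zvec f\<^esub> x = - x"
  by (rule group.inv_equality[OF group_Zvec]) (auto simp: monoid_vec_simps)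

lemma subgroup_ZvecD:
  assumes "subgroup L (Zvec f)"
  shows "L \<subseteq> carrier_vec f" "0\<^sub>v f \<in> L"
    and "x \<in> L \<Longrightarrow> y \<in> L \<Longrightarrow> x + y \<in> L"
    and "x \<in> L \<Longrightarrow> - x \<in> L"
    and "x \<in> L \<Longrightarrow> y \<in> L \<Longrightarrow> x - y \<in> L"
    and "x \<in> L \<Longrightarrow> c \<cdot>\<^sub>v x \<in> L"
proof -
  interpret subgroup L "Zvec f" by fact
  show sub: "L \<subseteq> carrier_vec f" and z: "0\<^sub>v f \<in> L"
    using subset one_closed by (simp_all add: monoid_vec_simps)
  show add: "x + y \<in> L" if "x \<in> L" "y \<in> L" for x y
    using m_closed that by (simp add: monoid_vec_simps)
  show um: "- x \<in> L" if "x \<in> L" for x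
  proof -
    have "inv\<^bsub>Zvec f\<^esub> x = - x"
      using sub that by (intro inv_Zvec) blast
    then show ?thesis using m_inv_closed[OF that] by (simp only:)
  qed
  show "x - y \<in> L" if "x \<in> L" "y \<in> L"
  proof -
    have "x - y = x + - y"
      using sub that by (intro minus_add_uminus_vec) blast+
    then show ?thesis
      using add[OF that(1) um[OF that(2)]] by (simp only:)
  qed
  show "c \<cdot>\<^sub>v x \<in> L" if x: "x \<in> L"
  proof -
    have xc: "x \<in> carrier_vec f"
      using x sub by blast
    show ?thesis
    proof (induction c rule: int_induct[where k = 0])
      case base
      have "0 \<cdot>\<^sub>v x = 0\<^sub>v f"
        using xc by (intro eq_vecI) auto
      then show ?case
        using z by simp
    next
      case (step1 i)
      have "(i + 1) \<cdot>\<^sub>v x = i \<cdot>\<^sub>v x + x"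
        using xc by (intro eq_vecI) (auto simp: algebra_simps)
      then show ?case
        using add[OF step1(2) x] by simp
    next
      case (step2 i)
      have "(i - 1) \<cdot>\<^sub>v x = i \<cdot>\<^sub>v x + - x"
        using xc by (intro eq_vecI) (auto simp: algebra_simps)
      then show ?case
        using add[OF step2(2) um[OF x]] by simp
    qed
  qed
qed

lemma Zvec_rcos_eq_iff:
  assumes "subgroup L (Zvec f)" "x \<in> carrier_vec f" "y \<in> carrier_vec f"
  shows "L #>\<^bsub>Zvec f\<^esub> x = L #>\<^bsub>Zvec f\<^esub> y \<longleftrightarrow> x - y \<in> L"
  using group.rcos_eq_iff[OF group_Zvec assms(1), of x y] assms
  by (simp add: monoid_vec_simps inv_Zvec flip: minus_add_uminus_vec[of x f y])

text \<open>Division with remainder, coordinate by coordinate from position \<open>k - 1\<close>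
  down to 0. As \<open>w i\<close> vanishes to the right of \<open>i\<close>, later corrections
  cannot spoil coordinates already in range; the vanishing of \<open>l\<close> from \<open>k\<close>
  on carries this fact through the induction.\<close>

lemma reduce_modulo_triangular:
  fixes x :: "int vec"
  assumes L: "subgroup L (Zvec f)" and "k \<le> f" "x \<in> carrier_vec f"
    and w: "\<And>i. i < k \<Longrightarrow> w i \<in> L" "\<And>i. i < k \<Longrightarrow> 0 < w i $ i"
    and tri: "\<And>i j. i < k \<Longrightarrow> i < j \<Longrightarrow> j < f \<Longrightarrow> w i $ j = 0"
  shows "\<exists>l\<in>L. (\<forall>j. k \<le> j \<and> j < f \<longrightarrow> l $ j = 0) \<and>
    (\<forall>j<k. 0 \<le> (x + l) $ j \<and> (x + l) $ j < w j $ j)"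
  using assms(2-)
proof (induction k arbitrary: x)
  case 0
  then show ?case
    using subgroup_ZvecD(2)[OF L] by (intro bexI[of _ "0\<^sub>v f"]) auto
next
  case (Suc k)
  note sub = subgroup_ZvecD[OF L]
  have wk: "w k \<in> carrier_vec f"
    using Suc.prems sub(1) by blast
  \<comment> \<open>Flooring division leaves \<open>x $ k mod w k $ k\<close> at position
    \<open>k\<close>, which is nonnegative for negative entries too.\<close>
  define l1 where "l1 = (- (x $ k div w k $ k)) \<cdot>\<^sub>v w k"
  have l1: "l1 \<in> L"
    unfolding l1_def using Suc.prems by (intro sub(6)) auto
  then have l1c: "l1 \<in> carrier_vec f" using sub(1) by blast
  have "\<exists>l\<in>L. (\<forall>j. k \<le> j \<and> j < f \<longrightarrow> l $ j = 0) \<and>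
    (\<forall>j<k. 0 \<le> (x + l1 + l) $ j \<and> (x + l1 + l) $ j < w j $ j)"
    using Suc.prems l1c by (intro Suc.IH) auto
  then obtain l2 where l2: "l2 \<in> L" "\<forall>j. k \<le> j \<and> j < f \<longrightarrow> l2 $ j = 0"
    "\<forall>j<k. 0 \<le> (x + l1 + l2) $ j \<and> (x + l1 + l2) $ j < w j $ j"
    by blast
  have l2c: "l2 \<in> carrier_vec f" using sub(1) l2 by blast
  have assoc: "x + (l1 + l2) = x + l1 + l2"
    using Suc.prems l1c l2c by simp
  have "(x + l1 + l2) $ k = x $ k mod w k $ k"
    using Suc.prems wk l2 l1c l2c by (simp add: l1_def minus_div_mult_eq_mod[symmetric])
  moreover have "0 < w k $ k" using Suc.prems by simp
  ultimately have "0 \<le> (x + l1 + l2) $ k \<and> (x + l1 + l2) $ k < w k $ k"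
    by simp
  then have "\<forall>j<Suc k. 0 \<le> (x + (l1 + l2)) $ j \<and> (x + (l1 + l2)) $ j < w j $ j"
    using l2(3) assoc by (simp add: less_Suc_eq)
  moreover have "\<forall>j. Suc k \<le> j \<and> j < f \<longrightarrow> (l1 + l2) $ j = 0"
    using l2(2) l1c l2c wk Suc.prems by (auto simp: l1_def)
  ultimately show ?case
    using sub(3)[OF l1 l2(1)] by blast
qed

lemma is_hnf_det:
  assumes "is_hnf f B"
  shows "det B = (\<Prod>i<f. B $$ (i, i))"
proof -
  have "det B = prod_list (diag_mat B)"
    using assms by (intro det_lower_triangular[of f]) (auto simp: is_hnf_def)
  also have "\<dots> = (\<Prod>i<f. B $$ (i, i))"
    using assms by (auto simp: prod_list_diag_prod is_hnf_def atLeast0LessThan)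
  finally show ?thesis .
qed

text \<open>The finite range of entries loses nothing: diagonal entries are positive and divide the
  determinant, and an entry below the diagonal is smaller than the diagonal entry of its
  column.\<close>

lemma set_hnf_list:
  "set (hnf_list f N) = {B. is_hnf f B \<and> det B = int N}"
proof -
  have "B \<in> set (hnf_list f N)" if B: "is_hnf f B" "det B = int N" for B
  proof -
    have pos: "\<forall>i<f. 0 < B $$ (i, i)" and dim: "B \<in> carrier_mat f f"
      using B by (simp_all add: is_hnf_def)
    have "0 < det B"
      unfolding is_hnf_det[OF B(1)] using pos by (intro prod_pos) auto
    then have N: "0 < N" using B(2) by simp
    have diag: "B $$ (i, i) \<le> int N" if "i < f" for i
      using that N is_hnf_det[OF B(1)] B(2)
      by (intro zdvd_imp_le) (auto intro!: dvd_prodI)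
    have entry: "0 \<le> B $$ (i, j) \<and> B $$ (i, j) \<le> int N" if "i < f" "j < f" for i j
    proof (cases i j rule: linorder_cases)
      case less
      then show ?thesis using B that by (simp add: is_hnf_def)
    next
      case equal
      then show ?thesis using pos diag that by (simp add: less_imp_le)
    next
      case greater
      then show ?thesis
        using B that diag[OF that(2)] unfolding is_hnf_def by (meson less_imp_le less_le_trans)
    qed
    define xs where "xs = map (\<lambda>k. B $$ (k div f, k mod f)) [0..<f * f]"
    have "k div f < f \<and> k mod f < f" if "k < f * f" for k
      using that by (cases "f = 0") (auto simp: less_mult_imp_div_less)
    then have "xs \<in> set (product_lists (replicate (f * f) [0..int N]))"
      using entry by (auto simp: product_lists_set xs_def list_all2_conv_all_nth)
    moreover have "B = mat f f (\<lambda>(i, j). xs ! (i * f + j))"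
    proof (rule eq_matI)
      fix i j assume "i < dim_row (mat f f (\<lambda>(i, j). xs ! (i * f + j)))"
        "j < dim_col (mat f f (\<lambda>(i, j). xs ! (i * f + j)))"
      then have ij: "i < f" "j < f" by auto
      have "i * f + j < Suc i * f" using ij by simp
      also have "\<dots> \<le> f * f" using ij by (intro mult_right_mono) auto
      finally show "B $$ (i, j) = mat f f (\<lambda>(i, j). xs ! (i * f + j)) $$ (i, j)"
        using ij by (simp add: xs_def)
    qed (use dim in auto)
    ultimately show ?thesis
      using B by (auto simp: hnf_list_def)
  qed
  then show ?thesis
    by (auto simp: hnf_list_def)
qed

lemma subgroup_row_lattice:
  "B \<in> carrier_mat n f \<Longrightarrow> subgroup (row_lattice B) (Zvec f)"
  unfolding row_lattice_def
  using group.generate_is_subgroup[OF group_Zvec, of "set (rows B)" f] rows_carrier[of B]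
  by (simp add: monoid_vec_simps carrier_matD)

lemma row_in_row_lattice: "i < dim_row B \<Longrightarrow> row B i \<in> row_lattice B"
  unfolding row_lattice_def by (rule generate.incl) (auto simp: rows_def)

lemma row_lattice_least:
  assumes "B \<in> carrier_mat n f" "subgroup L (Zvec f)" "\<And>i. i < n \<Longrightarrow> row B i \<in> L"
  shows "row_lattice B \<subseteq> L"
proof -
  have "set (rows B) \<subseteq> L" "dim_col B = f"
    using assms by (auto simp: rows_def)
  then show ?thesis
    unfolding row_lattice_def
    using group.generate_subgroup_incl[OF group_Zvec _ assms(2)] by simp
qed

text \<open>The integer combinations of the rows form a subgroup that contains the rows, hence they
  contain the generated lattice.\<close>

lemma row_lattice_combination:
  assumes B: "B \<in> carrier_mat n f" and x: "x \<in> row_lattice B"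
  shows "\<exists>c. x = vec f (\<lambda>j. \<Sum>i<n. c i * B $$ (i, j))"
proof -
  define S where "S = range (\<lambda>c. vec f (\<lambda>j. \<Sum>i<n. c i * B $$ (i, j)))"
  have "subgroup S (Zvec f)"
  proof
    show "S \<subseteq> carrier (Zvec f)"
      by (auto simp: S_def monoid_vec_simps)
    show "\<one>\<^bsub>Zvec f\<^esub> \<in> S"
      by (auto simp: S_def monoid_vec_simps intro!: image_eqI[of _ _ "\<lambda>_. 0"])
  next
    fix x y assume "x \<in> S" "y \<in> S"
    then obtain c d where "x = vec f (\<lambda>j. \<Sum>i<n. c i * B $$ (i, j))"
      "y = vec f (\<lambda>j. \<Sum>i<n. d i * B $$ (i, j))"
      by (auto simp: S_def)
    then have "x \<otimes>\<^bsub>Zvec f\<^esub> y = vec f (\<lambda>j. \<Sum>i<n. (c i + d i) * B $$ (i, j))"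
      by (auto simp: monoid_vec_simps algebra_simps sum.distrib)
    then show "x \<otimes>\<^bsub>Zvec f\<^esub> y \<in> S" by (auto simp: S_def)
  next
    fix x assume "x \<in> S"
    then obtain c where x: "x = vec f (\<lambda>j. \<Sum>i<n. c i * B $$ (i, j))"
      by (auto simp: S_def)
    then have "inv\<^bsub>Zvec f\<^esub> x = - x"
      by (intro inv_Zvec) simp
    also have "\<dots> = vec f (\<lambda>j. \<Sum>i<n. (- c i) * B $$ (i, j))"
      unfolding x by (intro eq_vecI) (auto simp: sum_negf)
    finally show "inv\<^bsub>Zvec f\<^esub> x \<in> S" unfolding S_def by (rule range_eqI[where x = "\<lambda>i. - c i"])
  qed
  moreover have "row B k \<in> S" if "k < n" for k
  proof -
    have "row B k = vec f (\<lambda>j. \<Sum>i<n. (if i = k then 1 else 0) * B $$ (i, j))"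
      using B that by (intro eq_vecI) (auto simp: if_distrib[where f = "\<lambda>x. x * _"] cong: if_cong)
    then show ?thesis by (auto simp: S_def)
  qed
  ultimately have "row_lattice B \<subseteq> S"
    by (rule row_lattice_least[OF B])
  then show ?thesis
    using x by (auto simp: S_def)
qed

text \<open>At the last row \<open>m\<close> with nonzero coefficient, earlier rows vanish in column
  \<open>m\<close> by triangularity and later rows do not contribute. So \<open>x $ m\<close> is a
  nonzero multiple of \<open>B $$ (m, m)\<close> and too large.\<close>

lemma is_hnf_small_lattice_vector:
  assumes B: "is_hnf f B" and x: "x \<in> row_lattice B"
    and small: "\<And>j. j < f \<Longrightarrow> \<bar>x $ j\<bar> < B $$ (j, j)"
  shows "x = 0\<^sub>v f"
proof -
  have dim: "B \<in> carrier_mat f f" using B by (simp add: is_hnf_def)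
  obtain c where c: "x = vec f (\<lambda>j. \<Sum>i<f. c i * B $$ (i, j))"
    using row_lattice_combination[OF dim x] by blast
  have "\<forall>i<f. c i = 0"
  proof (rule ccontr)
    assume "\<not> (\<forall>i<f. c i = 0)"
    define I where "I = {i. i < f \<and> c i \<noteq> 0}"
    have "finite I" "I \<noteq> {}"
      using \<open>\<not> (\<forall>i<f. c i = 0)\<close> by (auto simp: I_def)
    define m where "m = Max I"
    have m: "m < f" "c m \<noteq> 0" and max: "\<And>i. m < i \<Longrightarrow> i < f \<Longrightarrow> c i = 0"
      using Max_in[OF \<open>finite I\<close> \<open>I \<noteq> {}\<close>] Max_ge[OF \<open>finite I\<close>] leD
      by (fold m_def) (auto simp: I_def)
    have "x $ m = (\<Sum>i<f. c i * B $$ (i, m))"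
      using m c by simp
    also have "\<dots> = (\<Sum>i<f. if i = m then c m * B $$ (m, m) else 0)"
      using B m max unfolding is_hnf_def
      by (intro sum.cong refl) (auto, meson linorder_neqE_nat)
    also have "\<dots> = c m * B $$ (m, m)"
      using m by simp
    finally have "\<bar>c m\<bar> * \<bar>B $$ (m, m)\<bar> < B $$ (m, m)"
      using small[OF m(1)] by (simp add: abs_mult)
    moreover have "1 * \<bar>B $$ (m, m)\<bar> \<le> \<bar>c m\<bar> * \<bar>B $$ (m, m)\<bar>"
      using m(2) by (intro mult_right_mono) auto
    ultimately show False by linarith
  qed
  then show ?thesis
    using c by auto
qed

lemma is_hnf_lattice_index:
  assumes B: "is_hnf f B"
  shows "finite_index_sublattice f (row_lattice B)"
    and "int (lattice_index f (row_lattice B)) = det B"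
proof -
  let ?L = "row_lattice B" and ?c = "\<lambda>x. row_lattice B #>\<^bsub>Zvec f\<^esub> x"
  have dim: "B \<in> carrier_mat f f" and pos: "\<And>i. i < f \<Longrightarrow> 0 < B $$ (i, i)"
    and tri: "\<And>i j. i < f \<Longrightarrow> i < j \<Longrightarrow> j < f \<Longrightarrow> B $$ (i, j) = 0"
    using B by (auto simp: is_hnf_def)
  have L: "subgroup ?L (Zvec f)"
    by (rule subgroup_row_lattice[OF dim])
  note sub = subgroup_ZvecD[OF L]
  define box where "box = {x \<in> carrier_vec f. \<forall>i<f. 0 \<le> x $ i \<and> x $ i < B $$ (i, i)}"
  have "inj_on ?c box"
  proof (rule inj_onI)
    fix x y assume xy: "x \<in> box" "y \<in> box" "?c x = ?c y"
    then have c: "x \<in> carrier_vec f" "y \<in> carrier_vec f" by (auto simp: box_def)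
    \<comment> \<open>Two entries in the same half-open interval of length
      \<open>B $$ (j, j)\<close> differ by less than that length.\<close>
    have "x - y = 0\<^sub>v f"
    proof (rule is_hnf_small_lattice_vector[OF B])
      show "x - y \<in> ?L"
        using Zvec_rcos_eq_iff[OF L] c xy by blast
      show "\<bar>(x - y) $ j\<bar> < B $$ (j, j)" if "j < f" for j
      proof -
        have "0 \<le> x $ j" "x $ j < B $$ (j, j)" "0 \<le> y $ j" "y $ j < B $$ (j, j)"
          using xy that by (auto simp: box_def)
        then show ?thesis using c that by simp
      qed
    qed
    then show "x = y"
      using c by (metis eq_vecI carrier_vecD index_minus_vec(1) index_zero_vec(1) right_minus_eq)
  qed
  moreover have "?c ` box = rcosets\<^bsub>Zvec f\<^esub> ?L"
  proof
    show "?c ` box \<subseteq> rcosets\<^bsub>Zvec f\<^esub> ?L"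
      by (auto simp: box_def RCOSETS_def monoid_vec_simps)
    show "rcosets\<^bsub>Zvec f\<^esub> ?L \<subseteq> ?c ` box"
    proof
      fix C assume "C \<in> rcosets\<^bsub>Zvec f\<^esub> ?L"
      then obtain x where x: "x \<in> carrier_vec f" "C = ?c x"
        by (auto simp: RCOSETS_def monoid_vec_simps)
      obtain l where l: "l \<in> ?L" "\<forall>j<f. 0 \<le> (x + l) $ j \<and> (x + l) $ j < row B j $ j"
        using reduce_modulo_triangular[OF L order_refl x(1), of "row B"] dim pos tri
          row_in_row_lattice[of _ B] by auto
      then have lc: "l \<in> carrier_vec f" using sub(1) by blast
      then have "x + l \<in> box"
        using l(2) x dim by (auto simp: box_def)
      moreover have "x + l - x = l"
        using x lc by (intro eq_vecI) auto
      then have "?c (x + l) = ?c x"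
        using Zvec_rcos_eq_iff[OF L, of "x + l" x] x lc l by simp
      ultimately show "C \<in> ?c ` box"
        using x by (metis image_eqI)
    qed
  qed
  ultimately have bb: "bij_betw ?c box (rcosets\<^bsub>Zvec f\<^esub> ?L)"
    by (simp add: bij_betw_def)
  \<comment> \<open>The box is recast as an extensional function space so that its cardinality is
    the product of the diagonal entries.\<close>
  have "bij_betw (\<lambda>g. vec f g) (\<Pi>\<^sub>E i\<in>{..<f}. {0..<B $$ (i, i)}) box"
  proof (rule bij_betw_byWitness[where f' = "\<lambda>x. restrict (($) x) {..<f}"])
    show "\<forall>a\<in>(\<Pi>\<^sub>E i\<in>{..<f}. {0..<B $$ (i, i)}). restrict (($) (vec f a)) {..<f} = a"
      by (auto simp: PiE_def extensional_def restrict_def)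
    show "\<forall>a'\<in>box. vec f (restrict (($) a') {..<f}) = a'"
      by (auto simp: box_def)
    show "vec f ` (\<Pi>\<^sub>E i\<in>{..<f}. {0..<B $$ (i, i)}) \<subseteq> box"
      by (auto simp: box_def PiE_def Pi_def)
    show "(\<lambda>x. restrict (($) x) {..<f}) ` box \<subseteq> (\<Pi>\<^sub>E i\<in>{..<f}. {0..<B $$ (i, i)})"
      by (auto simp: box_def PiE_def Pi_def extensional_def)
  qed
  from bij_betw_trans[OF this bb]
  have b: "bij_betw (?c \<circ> vec f) (\<Pi>\<^sub>E i\<in>{..<f}. {0..<B $$ (i, i)}) (rcosets\<^bsub>Zvec f\<^esub> ?L)" .
  have "finite (\<Pi>\<^sub>E i\<in>{..<f}. {0..<B $$ (i, i)})"
    by (intro finite_PiE) auto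
  then show "finite_index_sublattice f ?L"
    using L b bij_betw_finite unfolding finite_index_sublattice_def by blast
  have "lattice_index f ?L = (\<Prod>i<f. nat (B $$ (i, i)))"
    using bij_betw_same_card[OF b] by (simp add: lattice_index_def card_PiE)
  then show "int (lattice_index f ?L) = det B"
    using pos by (simp add: is_hnf_det[OF B] less_imp_le)
qed

text \<open>Pigeonhole: the multiples of \<open>x\<close> fall into finitely many cosets, and the
  difference of two in the same coset is a positive multiple lying in \<open>L\<close>.\<close>

lemma finite_index_multiple:
  assumes L: "finite_index_sublattice f L" and x: "x \<in> carrier_vec f"
  shows "\<exists>n>0. int n \<cdot>\<^sub>v x \<in> L"
proof -
  have sub: "subgroup L (Zvec f)" and fin: "finite (rcosets\<^bsub>Zvec f\<^esub> L)"
    using L by (auto simp: finite_index_sublattice_def)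
  let ?c = "\<lambda>n :: nat. L #>\<^bsub>Zvec f\<^esub> (int n \<cdot>\<^sub>v x)"
  have "range ?c \<subseteq> rcosets\<^bsub>Zvec f\<^esub> L"
    using x by (auto simp: RCOSETS_def monoid_vec_simps intro!: bexI[of _ "_ \<cdot>\<^sub>v x"])
  then have "\<not> inj ?c"
    using fin finite_imageD finite_subset infinite_UNIV_nat by blast
  then obtain m n where mn: "m < n" "?c n = ?c m"
    unfolding inj_on_def by (metis linorder_neqE_nat)
  have "int n \<cdot>\<^sub>v x - int m \<cdot>\<^sub>v x \<in> L"
    using Zvec_rcos_eq_iff[OF sub] mn x by (metis smult_carrier_vec)
  also have "int n \<cdot>\<^sub>v x - int m \<cdot>\<^sub>v x = int (n - m) \<cdot>\<^sub>v x"
    using mn x by (intro eq_vecI) (auto simp: of_nat_diff algebra_simps)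
  finally show ?thesis
    using mn by (metis zero_less_diff)
qed

text \<open>Finite index puts a positive multiple of each unit vector into \<open>L\<close>, so
  every position has a vector to minimize over. The resulting rows generate \<open>L\<close>: an
  element of \<open>L\<close> reduced modulo the rows stays in \<open>L\<close>, and a nonzero
  remainder would have a last nonzero entry that is positive and below the minimum for its
  position.\<close>

lemma finite_index_sublattice_hnf:
  assumes L: "finite_index_sublattice f L"
  obtains B where "is_hnf f B" "row_lattice B = L"
proof -
  have sub: "subgroup L (Zvec f)"
    using L by (auto simp: finite_index_sublattice_def)
  note subD = subgroup_ZvecD[OF sub]
  define lead where "lead = (\<lambda>i d. 0 < d \<and> (\<exists>w\<in>L. w $ i = int d \<and> (\<forall>j. i < j \<and> j < f \<longrightarrow> w $ j = 0)))"
  define d where "d = (\<lambda>i. LEAST n. lead i n)"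
  have lead: "lead i (d i)" if i: "i < f" for i
  proof -
    obtain n where "n > 0" "int n \<cdot>\<^sub>v unit_vec f i \<in> L"
      using finite_index_multiple[OF L unit_vec_carrier] by blast
    then have "lead i n"
      using i unfolding lead_def by (intro conjI bexI[of _ "int n \<cdot>\<^sub>v unit_vec f i"]) auto
    then show ?thesis
      unfolding d_def by (rule LeastI)
  qed
  then have "\<forall>i\<in>{..<f}. \<exists>w. w \<in> L \<and> w $ i = int (d i) \<and> (\<forall>j. i < j \<and> j < f \<longrightarrow> w $ j = 0)"
    unfolding lead_def by blast
  then obtain w where w: "\<And>i. i < f \<Longrightarrow> w i \<in> L" "\<And>i. i < f \<Longrightarrow> w i $ i = int (d i)"
    "\<And>i j. i < f \<Longrightarrow> i < j \<Longrightarrow> j < f \<Longrightarrow> w i $ j = 0"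
    by (metis (no_types, lifting) lessThan_iff)
  have dpos: "0 < d i" if "i < f" for i
    using lead[OF that] by (simp add: lead_def)
  \<comment> \<open>The correction of \<open>w i\<close> vanishes from position \<open>i\<close> on,
    so the leading entry and the zeros to its right survive. It also reduces against the uncorrected
    \<open>w j\<close>, which is harmless because \<open>w j\<close> and its corrected form share
    the diagonal entry.\<close>
  have "\<exists>l\<in>L. (\<forall>j. i \<le> j \<and> j < f \<longrightarrow> l $ j = 0) \<and>
      (\<forall>j<i. 0 \<le> (w i + l) $ j \<and> (w i + l) $ j < w j $ j)" if "i < f" for i
    using that w subD(1) dpos by (intro reduce_modulo_triangular[OF sub]) auto
  then have "\<forall>i\<in>{..<f}. \<exists>l. l \<in> L \<and> (\<forall>j. i \<le> j \<and> j < f \<longrightarrow> l $ j = 0) \<and>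
      (\<forall>j<i. 0 \<le> (w i + l) $ j \<and> (w i + l) $ j < w j $ j)"
    by blast
  then obtain l where l: "\<And>i. i < f \<Longrightarrow> l i \<in> L" "\<And>i j. i < f \<Longrightarrow> i \<le> j \<Longrightarrow> j < f \<Longrightarrow> l i $ j = 0"
    "\<And>i j. i < f \<Longrightarrow> j < i \<Longrightarrow> 0 \<le> (w i + l i) $ j \<and> (w i + l i) $ j < w j $ j"
    by (metis (no_types, lifting) lessThan_iff)
  define B where "B = mat f f (\<lambda>(i, j). (w i + l i) $ j)"
  have dim: "B \<in> carrier_mat f f" by (simp add: B_def)
  have wl: "w i + l i \<in> L" "w i + l i \<in> carrier_vec f" "l i \<in> carrier_vec f" if "i < f" for i
    using w(1)[OF that] l(1)[OF that] subD(1,3) by blast+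
  have diag: "B $$ (i, i) = int (d i)" if "i < f" for i
    using that w(2)[OF that] l(2)[of i i] wl[OF that] by (simp add: B_def)
  have tri: "B $$ (i, j) = 0" if "i < j" "j < f" for i j
    using that w(3)[of i j] l(2)[of i j] wl[of i] by (simp add: B_def)
  have "0 \<le> B $$ (i, j) \<and> B $$ (i, j) < B $$ (j, j)" if "i < f" "j < i" for i j
    using that l(3)[OF that] w(2)[of j] diag[of j] by (simp add: B_def)
  then have hnf: "is_hnf f B"
    using dim diag tri dpos by (simp add: is_hnf_def)
  have row: "row B i \<in> L" if "i < f" for i
  proof -
    have "row B i = w i + l i"
      using that wl[OF that] by (intro eq_vecI) (auto simp: B_def)
    then show ?thesis using wl(1)[OF that] by simp
  qed
  have RB: "subgroup (row_lattice B) (Zvec f)"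
    by (rule subgroup_row_lattice[OF dim])
  have le: "row_lattice B \<subseteq> L"
    by (rule row_lattice_least[OF dim sub row])
  have "x \<in> row_lattice B" if x: "x \<in> L" for x
  proof -
    have xc: "x \<in> carrier_vec f" using x subD(1) by blast
    obtain b where b: "b \<in> row_lattice B" "\<forall>j<f. 0 \<le> (x + b) $ j \<and> (x + b) $ j < row B j $ j"
      using reduce_modulo_triangular[OF RB order_refl xc, of "row B"] dim diag tri dpos
        row_in_row_lattice[of _ B] by auto
    have bc: "b \<in> carrier_vec f" "b \<in> L" using b le subD(1) by blast+
    have xb: "x + b \<in> L" using subD(3) x bc by blast
    have "\<forall>j<f. (x + b) $ j = 0"
    proof (rule ccontr)
      define I where "I = {i. i < f \<and> (x + b) $ i \<noteq> 0}"
      assume "\<not> (\<forall>j<f. (x + b) $ j = 0)"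
      then have I: "finite I" "I \<noteq> {}" by (auto simp: I_def)
      define m where "m = Max I"
      have m: "m < f" "(x + b) $ m \<noteq> 0" and max: "\<And>i. m < i \<Longrightarrow> i < f \<Longrightarrow> (x + b) $ i = 0"
        using Max_in[OF I] Max_ge[OF I(1)] leD
        by (fold m_def) (auto simp: I_def)
      have bd: "0 < (x + b) $ m" "(x + b) $ m < int (d m)"
      proof -
        have "0 \<le> (x + b) $ m \<and> (x + b) $ m < row B m $ m"
          using b(2) m(1) by blast
        moreover have "row B m $ m = int (d m)"
          using diag[OF m(1)] dim m(1) by simp
        ultimately show "0 < (x + b) $ m" "(x + b) $ m < int (d m)"
          using m(2) by linarith+
      qed
      have "(x + b) $ m = int (nat ((x + b) $ m)) \<and> (\<forall>j. m < j \<and> j < f \<longrightarrow> (x + b) $ j = 0)"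
        using max bd(1) by auto
      with xb bd(1) have "lead m (nat ((x + b) $ m))"
        unfolding lead_def by (meson zero_less_nat_eq)
      then have "d m \<le> nat ((x + b) $ m)"
        unfolding d_def by (rule Least_le)
      then show False using bd by linarith
    qed
    then have "x = - b"
      using xc bc by (intro eq_vecI) auto
    then show ?thesis
      using subgroup_ZvecD(4)[OF RB b(1)] by simp
  qed
  then have "row_lattice B = L" using le by blast
  then show ?thesis using that hnf by blast
qed

theorem hnf_list_enumerates_sublattices:
  "row_lattice ` set (hnf_list f N) =
    {L. finite_index_sublattice f L \<and> lattice_index f L = N}"
proof (intro subset_antisym subsetI)
  fix L assume "L \<in> row_lattice ` set (hnf_list f N)"
  then obtain B where "is_hnf f B" "det B = int N" "L = row_lattice B"
    by (auto simp: set_hnf_list)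
  then show "L \<in> {L. finite_index_sublattice f L \<and> lattice_index f L = N}"
    using is_hnf_lattice_index[of f B] by simp
next
  fix L assume L: "L \<in> {L. finite_index_sublattice f L \<and> lattice_index f L = N}"
  then obtain B where "is_hnf f B" "row_lattice B = L"
    using finite_index_sublattice_hnf by blast
  with L show "L \<in> row_lattice ` set (hnf_list f N)"
    using is_hnf_lattice_index(2)[of f B] by (force simp: set_hnf_list)
qed

section \<open>Correctness of the search by increasing determinant\<close>

lemma lattice_index_pos:
  assumes "finite_index_sublattice f L"
  shows "0 < lattice_index f L"
proof -
  have "L \<in> rcosets\<^bsub>Zvec f\<^esub> L"
    using assms subgroup.subgroup_in_rcosets[OF _ group_Zvec]
    by (auto simp: finite_index_sublattice_def)
  then show ?thesis
    using assms by (auto simp: lattice_index_def finite_index_sublattice_def card_gt_0_iff)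
qed

text \<open>The loop invariant says that every positive index already passed has no successful
  basis. Starting at 1 misses nothing, since Hermite normal forms have positive determinant.\<close>

lemma hnf_search_Some:
  assumes B: "hnf_search f check = Some B"
  shows "is_hnf f B" "check B"
    and "\<And>B'. is_hnf f B' \<Longrightarrow> check B' \<Longrightarrow> det B \<le> det B'"
proof -
  let ?none = "\<lambda>N. List.find check (hnf_list f N) = None"
  obtain N where N: "while_option ?none Suc 1 = Some N" "B = the (List.find check (hnf_list f N))"
    using B by (auto simp: hnf_search_def)
  then have "\<not> ?none N"
    using while_option_stop by fast
  then have f: "List.find check (hnf_list f N) = Some B"
    using N(2) by auto
  then have BN: "B \<in> set (hnf_list f N)" "check B"
    by (auto simp: find_Some_iff)
  then show "is_hnf f B" "check B"
    by (auto simp: set_hnf_list)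
  have "\<forall>M. 0 < M \<and> M < N \<longrightarrow> ?none M"
    by (rule while_option_rule[where P = "\<lambda>N. \<forall>M. 0 < M \<and> M < N \<longrightarrow> ?none M", OF _ N(1)])
      (auto simp: less_Suc_eq)
  moreover fix B' assume B': "is_hnf f B'" "check B'"
  then have B'_list: "B' \<in> set (hnf_list f (nat (det B')))" "0 < det B'"
    using is_hnf_lattice_index[OF B'(1)] lattice_index_pos[of f "row_lattice B'"]
    by (auto simp: set_hnf_list)
  then have "\<not> ?none (nat (det B'))"
    using B'(2) by (auto simp: find_None_iff)
  ultimately have "N \<le> nat (det B')"
    using B'_list(2) by (metis not_less zero_less_nat_eq)
  then show "det B \<le> det B'"
    using BN B'_list by (simp add: set_hnf_list)
qed

text \<open>A loop that never ends has visited every index \<open>Suc k\<close> without success,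
  including the determinant of \<open>B\<close>.\<close>

lemma hnf_search_None:
  assumes "hnf_search f check = None" "is_hnf f B"
  shows "\<not> check B"
proof
  let ?none = "\<lambda>N. List.find check (hnf_list f N) = None"
  assume "check B"
  have Suc: "(Suc ^^ k) 1 = Suc k" for k by (induction k) auto
  have "while_option ?none Suc 1 = None"
    using assms(1) by (simp add: hnf_search_def)
  then have *: "?none (Suc k)" for k
    unfolding while_option_def Suc by (auto split: if_splits)
  have B: "B \<in> set (hnf_list f (nat (det B)))" "0 < det B"
    using is_hnf_lattice_index[OF assms(2)] lattice_index_pos[of f "row_lattice B"] assms(2)
    by (auto simp: set_hnf_list)
  have "?none (nat (det B))"
    using *[of "nat (det B) - 1"] B(2) by simp
  then show False
    using B(1) \<open>check B\<close> by (auto simp: find_None_iff)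
qed

section \<open>Crossing vectors as integer lifts of path labels\<close>

definition crossing_vec :: "('a \<times> 'a) set list \<Rightarrow> 'a list \<Rightarrow> int vec" where
  "crossing_vec Fs p = vec (length Fs) (\<lambda>j. net_crossing (Fs ! j) p)"

lemma crossing_vec_carrier [simp]: "crossing_vec Fs p \<in> carrier_vec (length Fs)"
  by (simp add: crossing_vec_def)

lemma net_crossing_Cons_Cons:
  "net_crossing F (x # y # p) = net_crossing F [x, y] + net_crossing F (y # p)"
  by (simp add: net_crossing_def steps_def)

lemma net_crossing_edge:
  "net_crossing F [x, y] = (if (x, y) \<in> F then 1 else 0) - (if (y, x) \<in> F then 1 else 0)"
  by (simp add: net_crossing_def steps_def)

lemma net_crossing_singleton: "net_crossing F [x] = 0"
  by (simp add: net_crossing_def steps_def)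

lemma crossing_vec_Cons_Cons:
  "crossing_vec Fs (x # y # p) = crossing_vec Fs [x, y] + crossing_vec Fs (y # p)"
  by (auto simp: crossing_vec_def net_crossing_Cons_Cons[of _ x y p])

lemma row_cycle_class_matrix:
  "i < length Bs \<Longrightarrow> row (cycle_class_matrix Fs Bs) i = crossing_vec Fs (Bs ! i @ [hd (Bs ! i)])"
  by (auto simp: cycle_class_matrix_def crossing_vec_def)

lemma cycle_class_matrix_carrier: "cycle_class_matrix Fs Bs \<in> carrier_mat (length Bs) (length Fs)"
  by (simp add: cycle_class_matrix_def)

text \<open>Injectivity of \<open>edge_of\<close> on the arcs of the partition means that exactly
  one direction of an edge is forward, so the crossing vector of a single edge is a unit vector or
  its negative.\<close>

lemma signed_gen_eq_coset:
  assumes Fs: "oriented_partition E Fs" and uv: "{u, v} \<in> E" "u \<noteq> v"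
  shows "signed_gen Fs Bs (u, v) =
    row_lattice (cycle_class_matrix Fs Bs) #>\<^bsub>Zvec (length Fs)\<^esub> crossing_vec Fs [u, v]"
proof -
  let ?t = "length Fs" and ?R = "row_lattice (cycle_class_matrix Fs Bs)"
  interpret Z: comm_group "Zvec ?t" by (rule comm_group_vec)
  have R: "subgroup ?R (Zvec ?t)"
    by (rule subgroup_row_lattice[OF cycle_class_matrix_carrier])
  interpret R: normal ?R "Zvec ?t"
    using R by (rule Z.subgroup_imp_normal)
  have "{u, v} \<in> edge_of ` \<Union>(set Fs)" and inj: "inj_on edge_of (\<Union>(set Fs))"
    using Fs uv unfolding oriented_partition_def bij_betw_def by blast+
  then have uv_Fs: "(u, v) \<in> \<Union>(set Fs) \<or> (v, u) \<in> \<Union>(set Fs)"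
    by (force simp: edge_of_def doubleton_eq_iff)
  have not_both: "\<not> ((u, v) \<in> \<Union>(set Fs) \<and> (v, u) \<in> \<Union>(set Fs))"
    using inj_onD[OF inj, of "(u, v)" "(v, u)"] uv(2) by (auto simp: edge_of_def insert_commute)
  have class_of: "(THE j. j < ?t \<and> a \<in> Fs ! j) < ?t \<and>
      (\<forall>i<?t. a \<in> Fs ! i \<longleftrightarrow> i = (THE j. j < ?t \<and> a \<in> Fs ! j))" if "a \<in> \<Union>(set Fs)" for a
    using theI'[OF oriented_partition_class[OF Fs that]] oriented_partition_class[OF Fs that] by blast
  have nth_not: "a \<notin> Fs ! i" if "a \<notin> \<Union>(set Fs)" "i < ?t" for a i
    using that nth_mem by blast
  show ?thesis
  proof (cases "(u, v) \<in> \<Union>(set Fs)")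
    case True
    define j where "j = (THE j. j < ?t \<and> (u, v) \<in> Fs ! j)"
    have j: "j < ?t" "\<And>i. i < ?t \<Longrightarrow> (u, v) \<in> Fs ! i \<longleftrightarrow> i = j"
      using class_of[OF True] by (auto simp: j_def)
    have "crossing_vec Fs [u, v] = unit_vec ?t j"
      using j nth_not not_both True by (intro eq_vecI) (auto simp: crossing_vec_def net_crossing_edge)
    then show ?thesis
      using True by (simp add: signed_gen_def univ_gen_def j_def)
  next
    case False
    then have vu: "(v, u) \<in> \<Union>(set Fs)" using uv_Fs by blast
    define j where "j = (THE j. j < ?t \<and> (v, u) \<in> Fs ! j)"
    have j: "j < ?t" "\<And>i. i < ?t \<Longrightarrow> (v, u) \<in> Fs ! i \<longleftrightarrow> i = j"
      using class_of[OF vu] by (auto simp: j_def)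
    have "crossing_vec Fs [u, v] = - unit_vec ?t j"
      using j nth_not False by (intro eq_vecI) (auto simp: crossing_vec_def net_crossing_edge)
    moreover have "inv\<^bsub>Zvec ?t Mod ?R\<^esub> (?R #>\<^bsub>Zvec ?t\<^esub> unit_vec ?t j) = ?R #>\<^bsub>Zvec ?t\<^esub> (- unit_vec ?t j)"
      by (simp add: R.inv_FactGroup R.rcos_inv carrier_FactGroup monoid_vec_simps inv_Zvec)
    ultimately show ?thesis
      using False by (simp add: signed_gen_def univ_gen_def univ_group_def j_def)
  qed
qed

text \<open>Lets labels be computed with integer vectors. Rows of the cycle-class matrix are
  crossing vectors of closed walks, so labels and relations are expressed in the same terms.\<close>

lemma path_sum_eq_coset:
  assumes Fs: "oriented_partition E Fs" and E: "simple_graph V E" and p: "walk V E p"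
  shows "path_sum Fs Bs p =
    row_lattice (cycle_class_matrix Fs Bs) #>\<^bsub>Zvec (length Fs)\<^esub> crossing_vec Fs p"
proof -
  let ?t = "length Fs" and ?R = "row_lattice (cycle_class_matrix Fs Bs)"
  interpret Z: comm_group "Zvec ?t" by (rule comm_group_vec)
  interpret R: normal ?R "Zvec ?t"
    using subgroup_row_lattice[OF cycle_class_matrix_carrier] by (rule Z.subgroup_imp_normal)
  show ?thesis
    using p
  proof (induction p rule: induct_list012)
    case 1
    then show ?case by (simp add: walk_def)
  next
    case (2 x)
    have "crossing_vec Fs [x] = \<one>\<^bsub>Zvec ?t\<^esub>"
      by (auto simp: crossing_vec_def net_crossing_singleton monoid_vec_simps)
    then show ?case
      by (simp add: path_sum_def steps_singleton univ_group_def R.subset)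
  next
    case (3 x y p)
    then have xy: "{x, y} \<in> E" "x \<noteq> y"
      using E by (auto simp: walk_Cons_Cons simple_graph_def doubleton_eq_iff)
    have "path_sum Fs Bs (x # y # p) =
        signed_gen Fs Bs (x, y) \<otimes>\<^bsub>univ_group Fs Bs\<^esub> path_sum Fs Bs (y # p)"
      by (simp add: path_sum_def steps_Cons_Cons)
    also have "\<dots> = ?R #>\<^bsub>Zvec ?t\<^esub> (crossing_vec Fs [x, y] \<otimes>\<^bsub>Zvec ?t\<^esub> crossing_vec Fs (y # p))"
      using 3 by (simp add: signed_gen_eq_coset[OF Fs xy] walk_Cons_Cons univ_group_def R.rcos_sum
          monoid_vec_simps(2))
    finally show ?case
      by (simp add: monoid_vec_simps crossing_vec_Cons_Cons[of Fs x y p])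
  qed
qed

section \<open>Lattice coordinates of a fold and minimality of the host found by the search\<close>

context free_part_decomposition
begin

definition free_coord :: "'b \<Rightarrow> int vec" where
  "free_coord x = snd (\<psi> x)"

lemma free_coord_hom:
  assumes "x \<in> carrier (host X)" "y \<in> carrier (host X)"
  shows "free_coord x \<in> carrier_vec f"
    and "free_coord (x \<otimes>\<^bsub>host X\<^esub> y) = free_coord x + free_coord y"
    and "free_coord (inv\<^bsub>host X\<^esub> x) = - free_coord x"
proof -
  show c: "free_coord x \<in> carrier_vec f"
    using \<psi>.hom_closed[OF assms(1)] by (auto simp: free_coord_def monoid_vec_simps)
  show "free_coord (x \<otimes>\<^bsub>host X\<^esub> y) = free_coord x + free_coord y"
    using \<psi>.hom_mult[OF assms] by (simp add: free_coord_def mult_DirProd' monoid_vec_simps)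
  have "snd \<circ> \<psi> \<in> hom (host X) (Zvec f)"
    using \<psi>.homh by (simp add: hom_pairwise)
  then interpret s: group_hom "host X" "Zvec f" "snd \<circ> \<psi>"
    by unfold_locales
  have "free_coord (inv\<^bsub>host X\<^esub> x) = inv\<^bsub>Zvec f\<^esub> free_coord x"
    using s.hom_inv[OF assms(1)] by (simp only: free_coord_def comp_apply)
  then show "free_coord (inv\<^bsub>host X\<^esub> x) = - free_coord x"
    using inv_Zvec[OF c] by (rule trans)
qed

lemma mem_fold_kernel_iff:
  assumes "carrier T = {\<one>\<^bsub>T\<^esub>}" "x \<in> carrier (host X)"
  shows "x \<in> K L \<longleftrightarrow> free_coord x \<in> L"
proof -
  have "\<psi> x \<in> carrier T \<times> carrier (Zvec f)"
    using \<psi>.hom_closed[OF assms(2)] by (simp only: carrier_DirProd)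
  then have "fst (\<psi> x) \<in> {\<one>\<^bsub>T\<^esub>}"
    unfolding assms(1) by (simp only: mem_Times_iff)
  then show ?thesis
    using assms(2) by (simp add: fold_kernel_def free_coord_def mem_Times_iff)
qed

lemma fold_lab_eq_iff:
  assumes T: "carrier T = {\<one>\<^bsub>T\<^esub>}" and X: "labelled_in_comm_group V X"
    and L: "subgroup L (Zvec f)" and uv: "u \<in> V" "v \<in> V"
  shows "lab (fold_by X T \<psi> L) u = lab (fold_by X T \<psi> L) v \<longleftrightarrow>
    free_coord (lab X u) - free_coord (lab X v) \<in> L"
proof -
  have u: "lab X u \<in> carrier (host X)" and v: "lab X v \<in> carrier (host X)"
    using X uv by (auto simp: labelled_in_comm_group_def)
  have "lab (fold_by X T \<psi> L) u = lab (fold_by X T \<psi> L) v \<longleftrightarrow>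
      lab X u \<otimes>\<^bsub>host X\<^esub> inv\<^bsub>host X\<^esub> lab X v \<in> K L"
    using G.rcos_eq_iff[OF subgroup_fold_kernel[OF L] u v]
    by (simp add: fold_by_def quotient_embedding_def)
  then show ?thesis
    using u v by (simp add: mem_fold_kernel_iff[OF T] free_coord_hom
        minus_add_uminus_vec[OF free_coord_hom(1) free_coord_hom(1)])
qed

lemma fold_adjacent_iff:
  assumes T: "carrier T = {\<one>\<^bsub>T\<^esub>}" and X: "labelled_in_comm_group V X"
    and L: "subgroup L (Zvec f)" and uv: "u \<in> V" "v \<in> V"
  shows "{lab (fold_by X T \<psi> L) u, lab (fold_by X T \<psi> L) v}
      \<in> cayley_edges (host (fold_by X T \<psi> L)) (connection_set (fold_by X T \<psi> L)) \<longleftrightarrow>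
    free_coord (lab X v) - free_coord (lab X u) \<notin> L \<and>
    (\<exists>g\<in>set (gens X). free_coord (lab X v) - free_coord (lab X u) + free_coord g \<in> L \<or>
                      free_coord (lab X v) - free_coord (lab X u) - free_coord g \<in> L)"
proof -
  have u: "lab X u \<in> carrier (host X)" and v: "lab X v \<in> carrier (host X)"
    and g: "\<And>g. g \<in> set (gens X) \<Longrightarrow> g \<in> carrier (host X)"
    using X uv by (auto simp: labelled_in_comm_group_def)
  let ?d = "lab X v \<otimes>\<^bsub>host X\<^esub> inv\<^bsub>host X\<^esub> lab X u"
  have d: "?d \<in> carrier (host X)" "free_coord ?d = free_coord (lab X v) - free_coord (lab X u)"
    using u v by (simp_all add: free_coord_hom minus_add_uminus_vec[OF free_coord_hom(1) free_coord_hom(1)])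
  have g': "?d \<otimes>\<^bsub>host X\<^esub> g \<in> K L \<longleftrightarrow> free_coord (lab X v) - free_coord (lab X u) + free_coord g \<in> L"
    "?d \<otimes>\<^bsub>host X\<^esub> inv\<^bsub>host X\<^esub> g \<in> K L \<longleftrightarrow> free_coord (lab X v) - free_coord (lab X u) - free_coord g \<in> L"
    if "g \<in> set (gens X)" for g
  proof -
    note c = free_coord_hom(1)[OF u u] free_coord_hom(1)[OF v v] free_coord_hom(1)[OF g[OF that] g[OF that]]
    show "?d \<otimes>\<^bsub>host X\<^esub> g \<in> K L \<longleftrightarrow> free_coord (lab X v) - free_coord (lab X u) + free_coord g \<in> L"
      using d(1) g[OF that] mem_fold_kernel_iff[OF T G.m_closed[OF d(1) g[OF that]]]
        free_coord_hom(2)[OF d(1) g[OF that]] d(2) by simp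
    show "?d \<otimes>\<^bsub>host X\<^esub> inv\<^bsub>host X\<^esub> g \<in> K L \<longleftrightarrow> free_coord (lab X v) - free_coord (lab X u) - free_coord g \<in> L"
      using mem_fold_kernel_iff[OF T G.m_closed[OF d(1) G.inv_closed[OF g[OF that]]]]
        free_coord_hom(2)[OF d(1) G.inv_closed[OF g[OF that]]] free_coord_hom(3)[OF g[OF that] d(1)]
        d(2) c by (simp add: minus_add_uminus_vec[of "free_coord (lab X v) - free_coord (lab X u)" f])
  qed
  show ?thesis
    using cayley_edge_quotient_iff[OF X subgroup_fold_kernel[OF L] u v] g' d(2)
      mem_fold_kernel_iff[OF T d(1)]
    by (simp add: fold_by_def quotient_embedding_def cong: bex_cong)
qed

lemma order_host_fold:
  assumes "finite_index_sublattice f L"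
  shows "order (host (fold_by X T \<psi> L)) = order T * lattice_index f L"
  using order_fold[of L] assms
  by (simp add: finite_index_sublattice_def fold_by_def quotient_embedding_def)

text \<open>Every sublattice of finite index is the row lattice of some Hermite normal form. Hence
  nontermination excludes all passing sublattices, and the first success can be compared with each
  of them by determinant.\<close>

theorem hnf_search_minimal_host:
  fixes V E
  defines "check \<equiv> \<lambda>L. passes_exact_check V E (fold_by X T \<psi> L)"
  shows "case hnf_search f (\<lambda>B. check (row_lattice B)) of
      None \<Rightarrow> {L. finite_index_sublattice f L \<and> check L} = {}
    | Some B \<Rightarrow> row_lattice B \<in> {L. finite_index_sublattice f L \<and> check L} \<and>
        (\<forall>L \<in> {L. finite_index_sublattice f L \<and> check L}.
          order (host (fold_by X T \<psi> (row_lattice B))) \<le> order (host (fold_by X T \<psi> L)))"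
proof (cases "hnf_search f (\<lambda>B. check (row_lattice B))")
  case None
  have "\<not> check L" if L: "finite_index_sublattice f L" for L
  proof -
    obtain B where "is_hnf f B" "row_lattice B = L"
      using finite_index_sublattice_hnf[OF L] .
    then show ?thesis
      using hnf_search_None[OF None] by blast
  qed
  then show ?thesis
    unfolding None by simp
next
  case (Some B)
  note B = hnf_search_Some[OF Some]
  have "order (host (fold_by X T \<psi> (row_lattice B))) \<le> order (host (fold_by X T \<psi> L))"
    if L: "finite_index_sublattice f L" "check L" for L
  proof -
    obtain B' where B': "is_hnf f B'" "row_lattice B' = L"
      using finite_index_sublattice_hnf[OF L(1)] .
    then have "det B \<le> det B'"
      using B(3) L(2) by blast
    then have "lattice_index f (row_lattice B) \<le> lattice_index f L"
      using is_hnf_lattice_index(2)[OF B(1)] is_hnf_lattice_index(2)[OF B'(1)] B'(2) by simp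
    then show ?thesis
      using L(1) is_hnf_lattice_index(1)[OF B(1)] by (simp add: order_host_fold)
  qed
  then show ?thesis
    using is_hnf_lattice_index(1)[OF B(1)] B(2) unfolding Some by simp
qed

end

lemma universal_embedding_decomposition:
  assumes "comm_group T" "\<psi> \<in> iso (univ_group Fs Bs) (T \<times>\<times> Zvec f)"
  shows "free_part_decomposition (universal_embedding Fs Bs P) T f \<psi>"
  using assms comm_group_univ_group[of Fs Bs]
  by (simp add: free_part_decomposition_def free_part_decomposition_axioms_def universal_embedding_def)

section \<open>The diamond\<close>

text \<open>The isomorphism supplied by \<open>FactGroup_iso_set\<close> sends a coset to the only
  element of its image under \<open>h\<close>; this evaluates it on a representative.\<close>

lemma (in group_hom) the_elem_image_coset_kernel:
  assumes "g \<in> carrier G"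
  shows "the_elem (h ` (kernel G H h #> g)) = h g"
proof -
  have "h y = h g" if "y \<in> kernel G H h #> g" for y
    using that assms by (auto simp: r_coset_def kernel_def)
  moreover have "g \<in> kernel G H h #> g"
    using assms subgroup_kernel G.rcos_self by blast
  ultimately show ?thesis
    by (metis (no_types, lifting) emptyE the_elem_image_unique)
qed

definition vec2 :: "int \<Rightarrow> int \<Rightarrow> int vec" where
  "vec2 a b = vec_of_list [a, b]"

lemma vec2_index [simp]: "vec2 a b $ 0 = a" "vec2 a b $ Suc 0 = b" "dim_vec (vec2 a b) = 2"
  by (simp_all add: vec2_def)

lemma vec2_carrier [simp]: "vec2 a b \<in> carrier_vec 2"
  by (intro carrier_vecI) simp

lemma eq_vec2_iff: "x \<in> carrier_vec 2 \<Longrightarrow> x = vec2 a b \<longleftrightarrow> x $ 0 = a \<and> x $ 1 = b"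
  by (auto intro!: eq_vecI simp: less_2_cases_iff)

lemma vec2_eq_iff [simp]: "vec2 a b = vec2 c d \<longleftrightarrow> a = c \<and> b = d"
  by (simp add: eq_vec2_iff)

lemma vec2_arith [simp]:
  "vec2 a b + vec2 c d = vec2 (a + c) (b + d)"
  "vec2 a b - vec2 c d = vec2 (a - c) (b - d)"
  "- vec2 a b = vec2 (- a) (- b)"
  "0\<^sub>v 2 = vec2 0 0"
  by (auto intro!: eq_vecI simp: less_2_cases_iff)

lemma row_lattice_vec2_iff:
  assumes "B \<in> carrier_mat 2 2"
  shows "vec2 a b \<in> row_lattice B \<longleftrightarrow>
    (\<exists>c d. a = c * B $$ (0, 0) + d * B $$ (1, 0) \<and> b = c * B $$ (0, 1) + d * B $$ (1, 1))"
proof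
  assume "vec2 a b \<in> row_lattice B"
  then obtain c where c: "vec2 a b = vec 2 (\<lambda>j. \<Sum>i<2. c i * B $$ (i, j))"
    using row_lattice_combination[OF assms] by blast
  have "vec2 a b $ j = (\<Sum>i<2. c i * B $$ (i, j))" if "j < 2" for j
    unfolding c using that by simp
  from this[of 0] this[of 1] show "\<exists>c d. a = c * B $$ (0, 0) + d * B $$ (1, 0) \<and> b = c * B $$ (0, 1) + d * B $$ (1, 1)"
    by (auto simp: numeral_2_eq_2)
next
  assume "\<exists>c d. a = c * B $$ (0, 0) + d * B $$ (1, 0) \<and> b = c * B $$ (0, 1) + d * B $$ (1, 1)"
  then obtain c d where "a = c * B $$ (0, 0) + d * B $$ (1, 0)" "b = c * B $$ (0, 1) + d * B $$ (1, 1)"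
    by blast
  then have "vec2 a b = c \<cdot>\<^sub>v row B 0 + d \<cdot>\<^sub>v row B 1"
    using assms by (intro eq_vecI) (auto simp: less_2_cases_iff)
  moreover have "row B 0 \<in> row_lattice B" "row B 1 \<in> row_lattice B"
    using assms by (auto intro: row_in_row_lattice)
  ultimately show "vec2 a b \<in> row_lattice B"
    using subgroup_ZvecD(3,6)[OF subgroup_row_lattice[OF assms]] by metis
qed

section \<open>The diamond graph, its metric and its oriented partition\<close>

lemma simple_graph_diamond: "simple_graph diamond_V diamond_E"
  unfolding simple_graph_def diamond_E_def by blast

lemma diamond_edge_iff:
  assumes "u \<in> diamond_V" "v \<in> diamond_V"
  shows "{u, v} \<in> diamond_E \<longleftrightarrow> u \<noteq> v \<and> {u, v} \<noteq> {0, 3}"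
proof -
  have "{u, v} \<in> {{u, v} | u v. u \<in> diamond_V \<and> v \<in> diamond_V \<and> u \<noteq> v} \<longleftrightarrow> u \<noteq> v"
    using assms by (auto simp: doubleton_eq_iff)
  then show ?thesis
    unfolding diamond_E_def by blast
qed

lemma diamond_E_eq: "diamond_E = {{0, 1}, {0, 2}, {1, 2}, {1, 3}, {2, 3}}"
proof
  show "diamond_E \<subseteq> {{0, 1}, {0, 2}, {1, 2}, {1, 3}, {2, 3}}"
  proof
    fix e assume e: "e \<in> diamond_E"
    then obtain u v where uv: "e = {u, v}" "u \<in> diamond_V" "v \<in> diamond_V"
      unfolding diamond_E_def by blast
    then have "u \<noteq> v" "\<not> (u = 0 \<and> v = 3)" "\<not> (u = 3 \<and> v = 0)"
      using diamond_edge_iff[OF uv(2,3)] e by (auto simp: insert_commute)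
    then show "e \<in> {{0, 1}, {0, 2}, {1, 2}, {1, 3}, {2, 3}}"
      using uv(2,3) unfolding uv(1) diamond_V_def insert_iff empty_iff
      by (elim disjE FalseE; simp add: doubleton_eq_iff)
  qed
  show "{{0, 1}, {0, 2}, {1, 2}, {1, 3}, {2, 3}} \<subseteq> diamond_E"
    by (simp add: diamond_edge_iff diamond_V_def doubleton_eq_iff)
qed

lemma finite_connected_diamond: "finite_connected_graph diamond_V diamond_E"
proof -
  have "\<exists>p. path_between diamond_V diamond_E u v p" if uv: "u \<in> diamond_V" "v \<in> diamond_V" for u v
  proof -
    consider "u = v" | "{u, v} \<in> diamond_E" | "u = 0" "v = 3" | "u = 3" "v = 0"
      using diamond_edge_iff[OF uv] unfolding doubleton_eq_iff by argo
    then show ?thesis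
    proof cases
      case 1
      then have "path_between diamond_V diamond_E u v [u]"
        using uv by (simp add: path_between_def walk_def)
      then show ?thesis by blast
    next
      case 2
      then have "path_between diamond_V diamond_E u v [u, v]"
        using uv diamond_edge_iff[OF uv] by (simp add: path_between_def walk_def)
      then show ?thesis by blast
    next
      case 3
      then have "path_between diamond_V diamond_E u v [0, 1, 3]"
        by (simp add: path_between_def walk_def doubleton_eq_iff diamond_E_eq diamond_V_def)
      then show ?thesis by blast
    next
      case 4
      then have "path_between diamond_V diamond_E u v [3, 1, 0]"
        by (simp add: path_between_def walk_def doubleton_eq_iff diamond_E_eq diamond_V_def)
      then show ?thesis by blast
    qed
  qed
  then show ?thesis
    using simple_graph_diamond by (simp add: finite_connected_graph_def diamond_V_def)
qed

lemma gdist_diamond: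
  assumes "u \<in> diamond_V" "v \<in> diamond_V"
  shows "gdist diamond_V diamond_E u v = (if u = v then 0 else if {u, v} = {0, 3} then 2 else 1)"
proof -
  have "{0, 1} \<in> diamond_E" "{1, 3} \<in> diamond_E" "{3, 1} \<in> diamond_E" "{1, 0} \<in> diamond_E"
    by (simp_all add: diamond_E_eq insert_commute)
  moreover have "1 \<in> diamond_V" by (simp add: diamond_V_def)
  moreover have "(u = 0 \<and> v = 3) \<or> (u = 3 \<and> v = 0)" if "{u, v} = {0, 3}"
    using that by (simp add: doubleton_eq_iff)
  ultimately show ?thesis
    using assms gdist_eq_1_iff[OF assms, of diamond_E] gdist_eq_2_iff[OF assms, of diamond_E]
      diamond_edge_iff[OF assms] by auto
qed

lemma oriented_partition_diamond: "oriented_partition diamond_E diamond_F"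
proof -
  have U: "\<Union>(set diamond_F) = {(0, 1), (2, 3), (0, 2), (1, 3), (1, 2)}"
    by (auto simp: diamond_F_def)
  have "inj_on edge_of (\<Union>(set diamond_F))"
    unfolding U by (simp add: edge_of_def doubleton_eq_iff)
  moreover have "edge_of ` \<Union>(set diamond_F) = diamond_E"
    unfolding U diamond_E_eq by (auto simp: edge_of_def)
  moreover have "\<forall>i<3. \<forall>j<3. i \<noteq> j \<longrightarrow> diamond_F ! i \<inter> diamond_F ! j = {}"
    by (simp add: diamond_F_def numeral_3_eq_3 All_less_Suc)
  moreover have "\<forall>j<3. diamond_F ! j \<noteq> {}"
    by (simp add: diamond_F_def numeral_3_eq_3 All_less_Suc)
  ultimately show ?thesis
    unfolding oriented_partition_def bij_betw_def by (simp add: diamond_F_def)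
qed

section \<open>A potential on the diamond and its universal group\<close>

lemma length_diamond_F [simp]: "length diamond_F = 3"
  by (simp add: diamond_F_def)

definition diamond_pos :: "nat \<Rightarrow> int vec" where
  "diamond_pos v = (if v = 0 then vec2 0 0 else if v = 1 then vec2 1 0 else if v = 2 then vec2 1 1 else vec2 2 1)"

text \<open>The linear map taking the three unit vectors to the class generators
  \<open>(1,0)\<close>, \<open>(1,1)\<close>, \<open>(0,1)\<close>; its kernel is spanned by
  \<open>(1,-1,1)\<close>.\<close>

definition diamond_proj :: "int vec \<Rightarrow> int vec" where
  "diamond_proj x = vec2 (x $ 0 + x $ 1) (x $ 1 + x $ 2)"

lemma diamond_proj_carrier [simp]: "diamond_proj x \<in> carrier_vec 2"
  by (simp add: diamond_proj_def)

lemma diamond_proj_add: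
  "y \<in> carrier_vec 3 \<Longrightarrow> diamond_proj (x + y) = diamond_proj x + diamond_proj y"
  by (simp add: diamond_proj_def)

text \<open>Along each arc \<open>diamond_pos\<close> changes by the generator of the class of that
  arc, so the contributions telescope. Applied to closed walks this constrains the relations,
  applied to root paths it gives the labels.\<close>

lemma diamond_proj_crossing_vec:
  "walk diamond_V diamond_E p \<Longrightarrow>
    diamond_proj (crossing_vec diamond_F p) = diamond_pos (last p) - diamond_pos (hd p)"
proof (induction p rule: induct_list012)
  case 1
  then show ?case by (simp add: walk_def)
next
  case (2 x)
  then show ?case
    by (simp add: diamond_proj_def crossing_vec_def net_crossing_singleton diamond_pos_def)
next
  case (3 x y p)
  then have "{x, y} \<in> diamond_E" by (simp add: walk_Cons_Cons)
  then have "(x, y) \<in> {(0, 1), (1, 0), (0, 2), (2, 0), (1, 2), (2, 1), (1, 3), (3, 1), (2, 3), (3, 2)}"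
    unfolding diamond_E_eq by (auto simp: doubleton_eq_iff)
  then have "diamond_proj (crossing_vec diamond_F [x, y]) = diamond_pos y - diamond_pos x"
    by (auto simp: diamond_proj_def crossing_vec_def net_crossing_edge diamond_F_def diamond_pos_def)
  moreover have "diamond_proj (crossing_vec diamond_F (x # y # p)) =
      diamond_proj (crossing_vec diamond_F [x, y]) + diamond_proj (crossing_vec diamond_F (y # p))"
    using crossing_vec_carrier[of diamond_F "y # p"]
    by (simp only: length_diamond_F crossing_vec_Cons_Cons[of diamond_F x y p] diamond_proj_add)
  moreover have "\<exists>a b. diamond_pos v = vec2 a b" for v
    by (auto simp: diamond_pos_def)
  then obtain a b c d e g where "diamond_pos x = vec2 a b" "diamond_pos y = vec2 c d"
    "diamond_pos (last (y # p)) = vec2 e g"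
    by metis
  ultimately show ?case
    using 3 by (simp add: walk_Cons_Cons del: last.simps) (simp add: last.simps)
qed

definition diamond_hom :: "int vec \<Rightarrow> unit \<times> int vec" where
  "diamond_hom x = ((), diamond_proj x)"

lemma mult_singleton_group [simp]: "x \<otimes>\<^bsub>singleton_group a\<^esub> y = a" "\<one>\<^bsub>singleton_group a\<^esub> = a"
  by (simp_all add: singleton_group_def)

lemma diamond_group_hom: "group_hom (Zvec 3) (singleton_group () \<times>\<times> Zvec 2) diamond_hom"
proof -
  have "group (singleton_group () \<times>\<times> Zvec 2)"
    by (intro DirProd_group group_Zvec) simp
  moreover have "diamond_hom \<in> hom (Zvec 3) (singleton_group () \<times>\<times> Zvec 2)"
    by (intro homI) (auto simp: diamond_hom_def monoid_vec_simps diamond_proj_add)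
  ultimately show ?thesis
    using group_Zvec by (simp add: group_hom_def group_hom_axioms_def)
qed

lemma kernel_diamond_hom:
  "kernel (Zvec 3) (singleton_group () \<times>\<times> Zvec 2) diamond_hom = {x \<in> carrier_vec 3. diamond_proj x = vec2 0 0}"
  by (auto simp: kernel_def diamond_hom_def monoid_vec_simps)

text \<open>The third class consists of the arc \<open>(1,2)\<close> alone. A cycle has three or
  four vertices here, so the places where it uses this edge can be listed, and distinctness of the
  vertices excludes a second passage.\<close>

lemma diamond_cycle_crossing:
  assumes b: "is_cycle diamond_V diamond_E b" and e: "{1, 2} \<in> cycle_edges b"
  shows "\<bar>net_crossing {(1, 2)} (b @ [hd b])\<bar> = 1"
proof -
  have "distinct b" "3 \<le> length b" "set b \<subseteq> diamond_V"
    using b by (auto simp: is_cycle_def walk_def)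
  moreover have "card (set b) \<le> 4"
    using card_mono[OF _ \<open>set b \<subseteq> diamond_V\<close>] by (simp add: diamond_V_def)
  ultimately have "length b = 3 \<or> length b = 4"
    using distinct_card[of b] by arith
  then consider x y z where "b = [x, y, z]" | x y z w where "b = [x, y, z, w]"
    by (auto simp: numeral_eq_Suc length_Suc_conv)
  then show ?thesis
  proof cases
    case 1
    have "x = 1 \<and> y = 2 \<or> x = 2 \<and> y = 1 \<or> y = 1 \<and> z = 2 \<or> y = 2 \<and> z = 1 \<or> z = 1 \<and> x = 2 \<or> z = 2 \<and> x = 1"
      using e by (simp add: 1 cycle_edges_def edge_of_def steps_def doubleton_eq_iff) argo
    then show ?thesis
      using \<open>distinct b\<close> unfolding 1
      by (elim disjE conjE) (simp_all add: net_crossing_def steps_def)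
  next
    case 2
    have "x = 1 \<and> y = 2 \<or> x = 2 \<and> y = 1 \<or> y = 1 \<and> z = 2 \<or> y = 2 \<and> z = 1 \<or>
        z = 1 \<and> w = 2 \<or> z = 2 \<and> w = 1 \<or> w = 1 \<and> x = 2 \<or> w = 2 \<and> x = 1"
      using e by (simp add: 2 cycle_edges_def edge_of_def steps_def doubleton_eq_iff) argo
    then show ?thesis
      using \<open>distinct b\<close> unfolding 2
      by (elim disjE conjE) (simp_all add: net_crossing_def steps_def)
  qed
qed

lemma diamond_row_lattice:
  assumes "cycle_basis diamond_V diamond_E Bs"
  shows "row_lattice (cycle_class_matrix diamond_F Bs) = {x \<in> carrier_vec 3. diamond_proj x = vec2 0 0}"
    (is "?R = ?M")
proof
  let ?A = "cycle_class_matrix diamond_F Bs"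
  have A: "?A \<in> carrier_mat (length Bs) 3"
    using cycle_class_matrix_carrier[of diamond_F Bs] by simp
  have M: "subgroup ?M (Zvec 3)"
    using group_hom.subgroup_kernel[OF diamond_group_hom] by (simp only: kernel_diamond_hom)
  have cyc: "is_cycle diamond_V diamond_E (Bs ! i)" if "i < length Bs" for i
    using assms that by (simp add: cycle_basis_def)
  have rowM: "row ?A i \<in> ?M" if i: "i < length Bs" for i
  proof -
    have "diamond_proj (row ?A i) = diamond_pos (last (Bs ! i @ [hd (Bs ! i)])) - diamond_pos (hd (Bs ! i @ [hd (Bs ! i)]))"
      unfolding row_cycle_class_matrix[OF i]
      using cyc[OF i] by (intro diamond_proj_crossing_vec) (simp add: is_cycle_def)
    also have "\<dots> = vec2 0 0"
    proof -
      have "Bs ! i \<noteq> []" using cyc[OF i] by (auto simp: is_cycle_def)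
      then show ?thesis by (simp add: diamond_pos_def)
    qed
    finally show ?thesis
      using A i by auto
  qed
  then show "?R \<subseteq> ?M"
    by (rule row_lattice_least[OF A M])
  define D :: "nat set set" where "D = {{0, 1}, {1, 2}, {0, 2}}"
  have "{e \<in> D. 0 \<in> e} = {{0, 1}, {0, 2}}" "{e \<in> D. 1 \<in> e} = {{0, 1}, {1, 2}}"
    "{e \<in> D. 2 \<in> e} = {{1, 2}, {0, 2}}" "{e \<in> D. 3 \<in> e} = {}"
    by (auto simp: D_def)
  then have "\<forall>v\<in>diamond_V. even (card {e \<in> D. v \<in> e})"
    unfolding diamond_V_def by (simp only: ball_simps) (simp add: doubleton_eq_iff)
  moreover have "D \<subseteq> diamond_E"
    by (simp add: D_def diamond_E_eq)
  ultimately have Dc: "D \<in> cycle_space diamond_V diamond_E"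
    unfolding cycle_space_def by (intro CollectI conjI)
  have "\<forall>D\<in>cycle_space diamond_V diamond_E. \<exists>I\<subseteq>{..<length Bs}. D = f2_sum Bs I"
    using assms unfolding cycle_basis_def by (elim conjE)
  from bspec[OF this Dc] obtain I where I: "I \<subseteq> {..<length Bs}" "D = f2_sum Bs I"
    by (elim exE conjE)
  have "{1, 2} \<in> D" by (simp add: D_def)
  then have "odd (card {i \<in> I. {1, 2} \<in> cycle_edges (Bs ! i)})"
    unfolding I(2) f2_sum_def by (rule CollectD)
  then have "card {i \<in> I. {1, 2} \<in> cycle_edges (Bs ! i)} \<noteq> 0"
    by (rule contrapos_nn) (simp only: even_zero)
  then have "{i \<in> I. {1, 2} \<in> cycle_edges (Bs ! i)} \<noteq> {}"
    by (intro notI) (simp only: card.empty)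
  then obtain i where "i \<in> {i \<in> I. {1, 2} \<in> cycle_edges (Bs ! i)}"
    unfolding ex_in_conv[symmetric] by (rule exE)
  then have "i \<in> I" and e: "{1, 2} \<in> cycle_edges (Bs ! i)"
    by (simp_all only: mem_Collect_eq)
  then have i: "i < length Bs"
    using I(1) by (simp only: subset_iff lessThan_iff)
  define r where "r = row ?A i"
  have "r $ 2 = net_crossing {(1, 2)} (Bs ! i @ [hd (Bs ! i)])"
    unfolding r_def row_cycle_class_matrix[OF i] by (simp add: crossing_vec_def diamond_F_def)
  then have "\<bar>r $ 2\<bar> = 1"
    using diamond_cycle_crossing[OF cyc[OF i] e] by simp
  \<comment> \<open>The sign of \<open>r $ 2\<close> depends on the sense in which the cycle is
    traversed. Being its own inverse, it can be used in the coefficient \<open>x $ 2 * r $ 2\<close>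
    below without splitting on the sign.\<close>
  then have r2: "r $ 2 * r $ 2 = 1"
    using abs_mult_self_eq[of "r $ 2"] by simp
  have "i < dim_row ?A" using A i by simp
  then have rR: "r \<in> ?R"
    unfolding r_def by (rule row_in_row_lattice)
  have "r \<in> ?M"
    unfolding r_def by (rule rowM[OF i])
  then have rc: "r \<in> carrier_vec 3" and "r $ 0 + r $ 1 = 0" "r $ 1 + r $ 2 = 0"
    by (simp_all add: diamond_proj_def)
  then have r: "r $ 0 = r $ 2" "r $ 1 = - r $ 2"
    by linarith+
  show "?M \<subseteq> ?R"
  proof
    fix x assume "x \<in> ?M"
    then have xc: "x \<in> carrier_vec 3" and "x $ 0 + x $ 1 = 0" "x $ 1 + x $ 2 = 0"
      by (simp_all add: diamond_proj_def)
    then have x: "x $ 0 = x $ 2" "x $ 1 = - x $ 2"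
      by linarith+
    have "x = (x $ 2 * r $ 2) \<cdot>\<^sub>v r"
    proof (rule eq_vecI)
      fix j assume "j < dim_vec ((x $ 2 * r $ 2) \<cdot>\<^sub>v r)"
      then have j: "j < 3" using rc by simp
      have "x $ 2 * r $ 2 * r $ 2 = x $ 2"
        using r2 by (simp add: mult.assoc)
      moreover have "j = 0 \<or> j = 1 \<or> j = 2" using j by arith
      ultimately have "x $ j = x $ 2 * r $ 2 * r $ j"
        using x r by (elim disjE) simp_all
      then show "x $ j = ((x $ 2 * r $ 2) \<cdot>\<^sub>v r) $ j"
        using j rc by simp
    qed (use xc rc in simp)
    then show "x \<in> ?R"
      by (rule ssubst[where P = "\<lambda>y. y \<in> ?R"]) (rule subgroup_ZvecD(6)[OF subgroup_row_lattice[OF A] rR])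
  qed
qed

definition diamond_iso :: "int vec set \<Rightarrow> unit \<times> int vec" where
  "diamond_iso C = the_elem (diamond_hom ` C)"

locale diamond_embedding =
  fixes Bs P
  assumes basis: "cycle_basis diamond_V diamond_E Bs"
    and paths: "root_paths diamond_V diamond_E 0 P"
begin

abbreviation "R \<equiv> row_lattice (cycle_class_matrix diamond_F Bs)"
abbreviation "X \<equiv> universal_embedding diamond_F Bs P"

lemma R_eq_kernel: "R = kernel (Zvec 3) (singleton_group () \<times>\<times> Zvec 2) diamond_hom"
  by (simp only: diamond_row_lattice[OF basis] kernel_diamond_hom)

lemma diamond_iso_coset:
  "x \<in> carrier_vec 3 \<Longrightarrow> diamond_iso (R #>\<^bsub>Zvec 3\<^esub> x) = ((), diamond_proj x)"
  using group_hom.the_elem_image_coset_kernel[OF diamond_group_hom, of x]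
  unfolding diamond_iso_def R_eq_kernel by (simp add: monoid_vec_simps diamond_hom_def)

lemma diamond_iso: "diamond_iso \<in> iso (host X) (singleton_group () \<times>\<times> Zvec 2)"
proof -
  interpret h: group_hom "Zvec 3" "singleton_group () \<times>\<times> Zvec 2" diamond_hom
    by (rule diamond_group_hom)
  have "diamond_hom ` carrier (Zvec 3) = carrier (singleton_group () \<times>\<times> Zvec 2)"
  proof
    show "carrier (singleton_group () \<times>\<times> Zvec 2) \<subseteq> diamond_hom ` carrier (Zvec 3)"
    proof
      fix p assume "p \<in> carrier (singleton_group () \<times>\<times> Zvec 2)"
      then obtain x where x: "p = ((), x)" "x \<in> carrier_vec 2"
        by (auto simp: monoid_vec_simps)
      \<comment> \<open>The first and third unit vectors already map to the standard basis, so they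
        suffice for a preimage.\<close>
      define y where "y = vec 3 (\<lambda>j. if j = 0 then x $ 0 else if j = 1 then 0 else x $ 1)"
      have "x = diamond_proj y"
        unfolding diamond_proj_def eq_vec2_iff[OF x(2)] by (simp add: y_def)
      then show "p \<in> diamond_hom ` carrier (Zvec 3)"
        using x by (auto simp: diamond_hom_def monoid_vec_simps y_def intro!: image_eqI[of _ _ y])
    qed
  qed (auto simp: diamond_hom_def monoid_vec_simps)
  from h.FactGroup_iso_set[OF this]
  show ?thesis
    by (simp add: diamond_iso_def[abs_def] R_eq_kernel universal_embedding_def univ_group_def)
qed

sublocale free_part_decomposition X "singleton_group ()" 2 diamond_iso
  using diamond_iso comm_group_univ_group[of diamond_F Bs]
  by (simp add: free_part_decomposition_def free_part_decomposition_axioms_def universal_embedding_def)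

lemma labelled: "labelled_in_comm_group diamond_V X"
  by (rule labelled_universal_embedding[OF oriented_partition_diamond paths])

lemma diamond_coord_gens:
  "map free_coord (gens X) = [vec2 1 0, vec2 1 1, vec2 0 1]"
proof -
  have "free_coord (univ_gen diamond_F Bs j) = diamond_proj (unit_vec 3 j)" for j
    by (simp add: free_coord_def univ_gen_def diamond_iso_coset)
  then show ?thesis
    by (simp add: universal_embedding_def diamond_proj_def upt_rec numeral_3_eq_3[symmetric])
qed

lemma diamond_coord_lab:
  assumes "v \<in> diamond_V"
  shows "free_coord (lab X v) = diamond_pos v"
proof -
  have p: "walk diamond_V diamond_E (P v)" "hd (P v) = 0" "last (P v) = v"
    using paths assms by (auto simp: root_paths_def path_between_def)
  have "lab X v = R #>\<^bsub>Zvec 3\<^esub> crossing_vec diamond_F (P v)"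
    using path_sum_eq_coset[OF oriented_partition_diamond simple_graph_diamond p(1)]
    by (simp add: universal_embedding_def)
  moreover have "crossing_vec diamond_F (P v) \<in> carrier_vec 3"
    using crossing_vec_carrier[of diamond_F "P v"] by simp
  ultimately have "free_coord (lab X v) = diamond_pos v - diamond_pos 0"
    using diamond_proj_crossing_vec[OF p(1)] p
    by (simp add: free_coord_def diamond_iso_coset)
  then show ?thesis
    by (auto simp: diamond_pos_def)
qed

end

section \<open>Sublattices of the plane: forbidden vectors, diagonal lattices and the index
  bound\<close>

lemma vec2_eta: "x \<in> carrier_vec 2 \<Longrightarrow> x = vec2 (x $ 0) (x $ 1)"
  using eq_vec2_iff by blast

lemma vec2_uminus_mem_iff:
  assumes "subgroup L (Zvec 2)"
  shows "vec2 (- a) (- b) \<in> L \<longleftrightarrow> vec2 a b \<in> L"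
  using subgroup_ZvecD(4)[OF assms, of "vec2 a b"] subgroup_ZvecD(4)[OF assms, of "vec2 (- a) (- b)"]
  by auto

text \<open>The diagonal matrix of the moduli is itself a Hermite normal form, so its determinant is
  the index.\<close>

lemma lattice_index_diagonal:
  assumes N: "\<forall>i<2. 0 < N i" and L: "L = {x \<in> carrier_vec 2. \<forall>i<2. int (N i) dvd x $ i}"
  shows "lattice_index 2 L = N 0 * N 1"
    and "vec2 a b \<in> L \<longleftrightarrow> int (N 0) dvd a \<and> int (N 1) dvd b"
proof -
  define B where "B = mat 2 2 (\<lambda>(i, j). if i = j then int (N i) else 0)"
  have B: "B \<in> carrier_mat 2 2" by (simp add: B_def)
  have hnf: "is_hnf 2 B"
    using N by (simp add: is_hnf_def B_def numeral_2_eq_2 All_less_Suc)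
  show mem: "vec2 a b \<in> L \<longleftrightarrow> int (N 0) dvd a \<and> int (N 1) dvd b" for a b
    by (auto simp: L less_2_cases_iff)
  have "vec2 a b \<in> row_lattice B \<longleftrightarrow> vec2 a b \<in> L" for a b
    unfolding row_lattice_vec2_iff[OF B] mem
    by (auto simp: B_def dvd_def mult.commute)
  moreover have "L \<subseteq> carrier_vec 2" "row_lattice B \<subseteq> carrier_vec 2"
    using subgroup_ZvecD(1)[OF subgroup_row_lattice[OF B]] by (auto simp: L)
  ultimately have "row_lattice B = L"
    using vec2_eta by (metis (no_types, opaque_lifting) subsetD subsetI subset_antisym)
  then have "int (lattice_index 2 L) = int (N 0) * int (N 1)"
    using is_hnf_lattice_index(2)[OF hnf] is_hnf_det[OF hnf]
    by (simp add: B_def numeral_2_eq_2 lessThan_Suc)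
  then show "lattice_index 2 L = N 0 * N 1"
    by (metis of_nat_eq_iff of_nat_mult)
qed

text \<open>The first four vectors are, up to sign, the differences of distinct labels. The others
  come from keeping vertices 0 and 3 nonadjacent: their difference is \<open>(2,1)\<close>, and
  adding or subtracting the generators gives \<open>(3,1)\<close>, \<open>(3,2)\<close>,
  \<open>(2,2)\<close>, \<open>(2,0)\<close> besides \<open>(1,1)\<close> and
  \<open>(1,0)\<close>.\<close>

definition diamond_avoids :: "int vec set \<Rightarrow> bool" where
  "diamond_avoids L \<longleftrightarrow>
     vec2 1 0 \<notin> L \<and> vec2 0 1 \<notin> L \<and> vec2 1 1 \<notin> L \<and> vec2 2 1 \<notin> L \<and>
     vec2 3 1 \<notin> L \<and> vec2 3 2 \<notin> L \<and> vec2 2 0 \<notin> L \<and> vec2 2 2 \<notin> L"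

lemma diamond_avoids_negative:
  assumes "subgroup L (Zvec 2)" "diamond_avoids L"
  shows "vec2 (-1) 0 \<notin> L" "vec2 0 (-1) \<notin> L" "vec2 (-1) (-1) \<notin> L" "vec2 (-2) (-1) \<notin> L"
    "vec2 (-3) (-1) \<notin> L" "vec2 (-3) (-2) \<notin> L" "vec2 (-2) 0 \<notin> L" "vec2 (-2) (-2) \<notin> L"
  using assms(2) vec2_uminus_mem_iff[OF assms(1), of 1 0] vec2_uminus_mem_iff[OF assms(1), of 0 1]
    vec2_uminus_mem_iff[OF assms(1), of 1 1] vec2_uminus_mem_iff[OF assms(1), of 2 1]
    vec2_uminus_mem_iff[OF assms(1), of 3 1] vec2_uminus_mem_iff[OF assms(1), of 3 2]
    vec2_uminus_mem_iff[OF assms(1), of 2 0] vec2_uminus_mem_iff[OF assms(1), of 2 2]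
  by (simp_all add: diamond_avoids_def)

lemma diamond_avoids_index:
  assumes L: "finite_index_sublattice 2 L" and A: "diamond_avoids L"
  shows "6 \<le> lattice_index 2 L"
proof -
  have sub: "subgroup L (Zvec 2)" and fin: "finite (rcosets\<^bsub>Zvec 2\<^esub> L)"
    using L by (simp_all add: finite_index_sublattice_def)
  let ?c = "\<lambda>x. L #>\<^bsub>Zvec 2\<^esub> x"
  \<comment> \<open>The four labels together with the inverses of those of vertices 1 and 2. For
    example, \<open>(2,1)\<close> minus the two negative vectors gives \<open>(3,1)\<close> and
    \<open>(3,2)\<close>, and the opposite pairs give \<open>(2,0)\<close> and
    \<open>(2,2)\<close>.\<close>
  define xs where "xs = [vec2 0 0, vec2 1 0, vec2 1 1, vec2 2 1, vec2 (-1) 0, vec2 (-1) (-1)]"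
  have "distinct (map ?c xs)"
    using A diamond_avoids_negative[OF sub A]
    by (simp add: xs_def Zvec_rcos_eq_iff[OF sub] diamond_avoids_def)
  then have "card (set (map ?c xs)) = 6"
    by (simp only: distinct_card) (simp add: xs_def)
  moreover have "set (map ?c xs) \<subseteq> rcosets\<^bsub>Zvec 2\<^esub> L"
    by (auto simp: xs_def RCOSETS_def monoid_vec_simps)
  ultimately show ?thesis
    unfolding lattice_index_def using card_mono[OF fin] by metis
qed

lemma diagonal_index_6_not_avoids:
  assumes "diagonal_lattice 2 L" "lattice_index 2 L = 6"
  shows "\<not> diamond_avoids L"
proof
  assume A: "diamond_avoids L"
  obtain N where N: "\<forall>i<2. 0 < N i" "L = {x \<in> carrier_vec 2. \<forall>i<2. int (N i) dvd x $ i}"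
    using assms(1) unfolding diagonal_lattice_def by blast
  note mem = lattice_index_diagonal(2)[OF N]
  have prod: "N 0 * N 1 = 6"
    using lattice_index_diagonal(1)[OF N] assms(2) by simp
  then have "N 0 dvd 6" by (metis dvd_triv_left)
  then have "N 0 \<le> 6" by (rule dvd_imp_le) simp
  then have "N 0 \<in> {0, 1, 2, 3, 4, 5, 6}"
    by (simp, arith)
  then have "(N 0 = 1 \<and> N 1 = 6) \<or> (N 0 = 2 \<and> N 1 = 3) \<or> (N 0 = 3 \<and> N 1 = 2) \<or> (N 0 = 6 \<and> N 1 = 1)"
    using prod by (elim insertE; simp; presburger?)
  \<comment> \<open>The four factorizations are excluded by \<open>(1,0)\<close>,
    \<open>(2,0)\<close>, \<open>(3,2)\<close> and \<open>(0,1)\<close> respectively, each lying in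
    the lattice in question.\<close>
  then show False
    using A unfolding diamond_avoids_def mem by (elim disjE) simp_all
qed

abbreviation "octahedral_lattice \<equiv> row_lattice (mat_of_rows_list 2 [[3, 0], [1, 2]])"

text \<open>The given basis is already a Hermite normal form, with determinant 6. The congruences
  present the lattice as the kernel of the map sending \<open>(a,b)\<close> to
  \<open>(b mod 2, (a + b) mod 3)\<close>, from which the isomorphism with \<open>Z2xZ3\<close> is
  built.\<close>

lemma octahedral_lattice:
  shows "finite_index_sublattice 2 octahedral_lattice"
    and "lattice_index 2 octahedral_lattice = 6"
    and "vec2 a b \<in> octahedral_lattice \<longleftrightarrow> even b \<and> 3 dvd a + b"
proof -
  let ?B = "mat_of_rows_list 2 [[3, 0], [1, 2]] :: int mat"
  have hnf: "is_hnf 2 ?B"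
    by (simp add: is_hnf_def mat_of_rows_list_def numeral_2_eq_2 All_less_Suc)
  show "finite_index_sublattice 2 octahedral_lattice"
    by (rule is_hnf_lattice_index(1)[OF hnf])
  have "int (lattice_index 2 octahedral_lattice) = 6"
    using is_hnf_lattice_index(2)[OF hnf] is_hnf_det[OF hnf]
    by (simp add: mat_of_rows_list_def numeral_2_eq_2 lessThan_Suc)
  then show "lattice_index 2 octahedral_lattice = 6"
    by simp
  have B: "?B \<in> carrier_mat 2 2"
    using hnf by (simp add: is_hnf_def)
  have "vec2 a b \<in> octahedral_lattice \<longleftrightarrow> (\<exists>c d. a = c * 3 + d \<and> b = d * 2)"
    unfolding row_lattice_vec2_iff[OF B] by (simp add: mat_of_rows_list_def)
  also have "\<dots> \<longleftrightarrow> even b \<and> 3 dvd a + b"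
    by presburger
  finally show "vec2 a b \<in> octahedral_lattice \<longleftrightarrow> even b \<and> 3 dvd a + b" .
qed

lemma octahedral_lattice_avoids: "diamond_avoids octahedral_lattice"
  by (simp add: diamond_avoids_def octahedral_lattice(3))

lemma octahedral_lattice_not_diagonal: "\<not> diagonal_lattice 2 octahedral_lattice"
  using diagonal_index_6_not_avoids octahedral_lattice(2) octahedral_lattice_avoids by blast

section \<open>The octahedron as a Cayley graph\<close>

abbreviation "Z2xZ3 \<equiv> integer_mod_group 2 \<times>\<times> integer_mod_group 3"

lemma Z2xZ3_simps:
  "carrier Z2xZ3 = {0, 1} \<times> {0, 1, 2}"
  "\<one>\<^bsub>Z2xZ3\<^esub> = (0, 0)"
  "(a, b) \<otimes>\<^bsub>Z2xZ3\<^esub> (c, d) = ((a + c) mod 2, (b + d) mod 3)"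
  "inv\<^bsub>Z2xZ3\<^esub> (0, 1) = (0, 2)"
  "inv\<^bsub>Z2xZ3\<^esub> (1, 1) = (1, 2)"
proof -
  have "{0..<2} = {0, 1 :: int}" "{0..<3} = {0, 1, 2 :: int}" by auto
  then show "carrier Z2xZ3 = {0, 1} \<times> {0, 1, 2}"
    by (simp add: carrier_integer_mod_group)
qed (simp_all add: inv_DirProd carrier_integer_mod_group)

lemma group_Z2xZ3: "group Z2xZ3"
  by (intro DirProd_group) simp_all

lemma octahedron_isomorphic:
  "graph_isomorphic (carrier Z2xZ3)
    (cayley_edges Z2xZ3 {(0, 1), inv\<^bsub>Z2xZ3\<^esub> (0, 1), (1, 1), inv\<^bsub>Z2xZ3\<^esub> (1, 1)})
    octahedron_V octahedron_E"
proof -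
  let ?S = "{(0, 1), (0, 2), (1, 1), (1, 2)} :: (int \<times> int) set"
  \<comment> \<open>The only nonidentity element outside the connection set is \<open>(1,0)\<close>,
    so the nonadjacent pairs are \<open>(0,j)\<close> and \<open>(1,j)\<close>; they must be sent to
    antipodes, which sum to 5.\<close>
  define h :: "int \<times> int \<Rightarrow> nat" where "h = (\<lambda>(i, j). if i = 0 then nat j else nat (5 - j))"
  have C: "carrier Z2xZ3 = {(0, 0), (0, 1), (0, 2), (1, 0), (1, 1), (1, 2)}"
    unfolding Z2xZ3_simps by auto
  have "inv\<^bsub>Z2xZ3\<^esub> (0, 2) = (0, 1)" "inv\<^bsub>Z2xZ3\<^esub> (1, 2) = (1, 1)"
    by (simp_all add: inv_DirProd carrier_integer_mod_group)
  then have inv: "inv\<^bsub>Z2xZ3\<^esub> s \<in> ?S" if "s \<in> ?S" for s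
    using that by (auto simp: Z2xZ3_simps)
  have S: "?S \<subseteq> carrier Z2xZ3"
    unfolding C by blast
  have edge: "{u, v} \<in> cayley_edges Z2xZ3 ?S \<longleftrightarrow> (\<exists>s\<in>?S. v = u \<otimes>\<^bsub>Z2xZ3\<^esub> s)"
    if "u \<in> carrier Z2xZ3" "v \<in> carrier Z2xZ3" for u v
    using cayley_edge_iff[OF group_Z2xZ3 S inv that] .
  have oct: "{m, n} \<in> octahedron_E \<longleftrightarrow> m < 6 \<and> n < 6 \<and> m \<noteq> n \<and> m + n \<noteq> 5" for m n
    unfolding octahedron_E_def by (auto simp: doubleton_eq_iff add.commute)
  have "bij_betw h (carrier Z2xZ3) octahedron_V"
  proof -
    have "inj_on h (carrier Z2xZ3)"
      unfolding C by (simp add: h_def)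
    moreover have "h ` carrier Z2xZ3 = {0, 1, 2, 3, 4, 5}"
      unfolding C by (simp add: h_def insert_commute)
    moreover have "octahedron_V = {0, 1, 2, 3, 4, 5}"
      unfolding octahedron_V_def by auto
    ultimately show ?thesis
      unfolding bij_betw_def by blast
  qed
  moreover have "\<forall>u\<in>carrier Z2xZ3. \<forall>v\<in>carrier Z2xZ3.
      (\<exists>s\<in>?S. v = u \<otimes>\<^bsub>Z2xZ3\<^esub> s) \<longleftrightarrow> h u < 6 \<and> h v < 6 \<and> h u \<noteq> h v \<and> h u + h v \<noteq> 5"
    unfolding C by (simp add: h_def)
  ultimately show ?thesis
    unfolding graph_isomorphic_def Z2xZ3_simps(4,5)
    using edge oct by (intro exI[of _ h]) simp
qed

section \<open>Folds of the diamond\<close>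

context diamond_embedding
begin

abbreviation "fold_X L \<equiv> fold_by X (singleton_group ()) diamond_iso L"

lemma bex_gens_iff:
  "(\<exists>g\<in>set (gens X). Q (free_coord g)) \<longleftrightarrow> Q (vec2 1 0) \<or> Q (vec2 1 1) \<or> Q (vec2 0 1)"
proof -
  have "(\<exists>g\<in>set (gens X). Q (free_coord g)) \<longleftrightarrow> (\<exists>c\<in>set (map free_coord (gens X)). Q c)"
    by (simp only: set_map bex_simps)
  then show ?thesis
    unfolding diamond_coord_gens by simp
qed

lemma diamond_lab_eq_iff:
  assumes "subgroup L (Zvec 2)" "u \<in> diamond_V" "v \<in> diamond_V"
  shows "lab (fold_X L) u = lab (fold_X L) v \<longleftrightarrow> diamond_pos u - diamond_pos v \<in> L"
  using fold_lab_eq_iff[OF _ labelled assms] assms(2,3) by (simp add: diamond_coord_lab)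

lemma diamond_adjacent_iff:
  assumes "subgroup L (Zvec 2)" "u \<in> diamond_V" "v \<in> diamond_V"
  defines "d \<equiv> diamond_pos v - diamond_pos u"
  shows "{lab (fold_X L) u, lab (fold_X L) v} \<in> cayley_edges (host (fold_X L)) (connection_set (fold_X L)) \<longleftrightarrow>
    d \<notin> L \<and> (d + vec2 1 0 \<in> L \<or> d - vec2 1 0 \<in> L \<or> d + vec2 1 1 \<in> L \<or> d - vec2 1 1 \<in> L \<or>
      d + vec2 0 1 \<in> L \<or> d - vec2 0 1 \<in> L)"
  using fold_adjacent_iff[OF _ labelled assms(1-3)] assms(2,3)
    bex_gens_iff[of "\<lambda>c. d + c \<in> L \<or> d - c \<in> L"]
  by (simp add: diamond_coord_lab d_def[symmetric])

lemma lab_fold_closed: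
  assumes "subgroup L (Zvec 2)" "u \<in> diamond_V"
  shows "lab (fold_X L) u \<in> carrier (host (fold_X L))"
  using labelled_quotient[OF labelled subgroup_fold_kernel[OF assms(1)]] assms(2)
  by (auto simp: labelled_in_comm_group_def fold_by_def)

text \<open>Labels of adjacent vertices differ by a generator up to sign, so in any fold they stay
  adjacent as soon as they are distinct. What can fail is distinctness of labels or nonadjacency of
  the images of 0 and 3; if both hold, vertex 1 provides a walk of length 2 between the
  latter.\<close>

lemma diamond_isometric_iff:
  assumes L: "subgroup L (Zvec 2)"
  shows "isometric diamond_V diamond_E (fold_X L) \<longleftrightarrow> diamond_avoids L"
proof
  let ?E = "cayley_edges (host (fold_X L)) (connection_set (fold_X L))"
  have V: "0 \<in> diamond_V" "1 \<in> diamond_V" "2 \<in> diamond_V" "3 \<in> diamond_V"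
    by (simp_all add: diamond_V_def)
  assume iso: "isometric diamond_V diamond_E (fold_X L)"
  have ne: "diamond_pos u - diamond_pos v \<notin> L" if "u \<in> diamond_V" "v \<in> diamond_V" "u \<noteq> v" for u v
    using iso that diamond_lab_eq_iff[OF L that(1,2)] unfolding isometric_def inj_on_def by blast
  have "gdist (carrier (host (fold_X L))) ?E (lab (fold_X L) 0) (lab (fold_X L) 3) = 2"
    using iso V gdist_diamond[OF V(1,4)] by (simp add: isometric_def)
  then have "{lab (fold_X L) 0, lab (fold_X L) 3} \<notin> ?E"
    using gdist_eq_2_iff[OF lab_fold_closed[OF L V(1)] lab_fold_closed[OF L V(4)]] by blast
  then show "diamond_avoids L"
    using ne[OF V(2,1)] ne[OF V(3,2)] ne[OF V(3,1)] ne[OF V(4,1)] diamond_adjacent_iff[OF L V(1,4)]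
    by (simp add: diamond_pos_def diamond_avoids_def)
next
  let ?E = "cayley_edges (host (fold_X L)) (connection_set (fold_X L))"
  let ?d = "gdist (carrier (host (fold_X L))) ?E"
  assume A: "diamond_avoids L"
  note A' = A[unfolded diamond_avoids_def] diamond_avoids_negative[OF L A]
  have zero: "vec2 0 0 \<in> L"
    using subgroup_ZvecD(2)[OF L] by simp
  have ne: "lab (fold_X L) u \<noteq> lab (fold_X L) v" if "u \<in> diamond_V" "v \<in> diamond_V" "u \<noteq> v" for u v
  proof -
    have "diamond_pos u - diamond_pos v \<notin> L"
      using that A' unfolding diamond_V_def by (elim insertE emptyE) (simp_all add: diamond_pos_def)
    then show ?thesis
      using diamond_lab_eq_iff[OF L that(1,2)] by blast
  qed
  have adj: "{lab (fold_X L) u, lab (fold_X L) v} \<in> ?E \<longleftrightarrow> {u, v} \<noteq> {0, 3}"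
    if uv: "u \<in> diamond_V" "v \<in> diamond_V" "u \<noteq> v" for u v
    unfolding diamond_adjacent_iff[OF L uv(1,2)] doubleton_eq_iff
    using uv A' zero unfolding diamond_V_def
    by (elim insertE emptyE) (simp_all add: diamond_pos_def)
  have "?d (lab (fold_X L) u) (lab (fold_X L) v) = gdist diamond_V diamond_E u v"
    if uv: "u \<in> diamond_V" "v \<in> diamond_V" for u v
  proof -
    note c = lab_fold_closed[OF L uv(1)] lab_fold_closed[OF L uv(2)]
    consider "u = v" | "u \<noteq> v" "{u, v} \<noteq> {0, 3}" | "u \<noteq> v" "{u, v} = {0, 3}"
      by blast
    then show ?thesis
    proof cases
      case 1
      then show ?thesis using c uv by simp
    next
      case 2
      then show ?thesis
        using gdist_eq_1_iff[OF c] ne[OF uv] adj[OF uv] gdist_diamond[OF uv] by simp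
    next
      case 3
      have "1 \<in> diamond_V" by (simp add: diamond_V_def)
      moreover have "u \<noteq> 1" "v \<noteq> 1" "{u, 1} \<noteq> {0, 3}" "{1, v} \<noteq> {0, 3}"
        using 3 by (auto simp: doubleton_eq_iff)
      ultimately have "{lab (fold_X L) u, lab (fold_X L) 1} \<in> ?E" "{lab (fold_X L) 1, lab (fold_X L) v} \<in> ?E"
        using adj[OF uv(1)] adj[OF _ uv(2)] by metis+
      then have "?d (lab (fold_X L) u) (lab (fold_X L) v) = 2"
        unfolding gdist_eq_2_iff[OF c] using ne[OF uv] adj[OF uv] 3 lab_fold_closed[OF L \<open>1 \<in> diamond_V\<close>]
        by blast
      then show ?thesis
        using 3 gdist_diamond[OF uv] by simp
    qed
  qed
  then show "isometric diamond_V diamond_E (fold_X L)"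
    unfolding isometric_def inj_on_def using ne by blast
qed

lemma diamond_passes_iff:
  assumes "finite_index_sublattice 2 L"
  shows "passes_exact_check diamond_V diamond_E (fold_X L) \<longleftrightarrow> diamond_avoids L"
    and "isometric_finite_quotient diamond_V diamond_E X (K L) \<longleftrightarrow> diamond_avoids L"
proof -
  have L: "subgroup L (Zvec 2)" "finite (rcosets\<^bsub>Zvec 2\<^esub> L)"
    using assms by (simp_all add: finite_index_sublattice_def)
  show "isometric_finite_quotient diamond_V diamond_E X (K L) \<longleftrightarrow> diamond_avoids L"
    using diamond_isometric_iff[OF L(1)] subgroup_fold_kernel[OF L(1)] finite_fold_iff[OF L(1)] L(2)
    by (simp add: isometric_finite_quotient_def fold_by_def)
  then show "passes_exact_check diamond_V diamond_E (fold_X L) \<longleftrightarrow> diamond_avoids L"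
    using fold_passes_iff[OF finite_connected_diamond labelled _ assms] by simp
qed

lemma order_diamond_fold:
  "finite_index_sublattice 2 L \<Longrightarrow> order (host (fold_X L)) = lattice_index 2 L"
  using order_host_fold[of L] by (simp add: order_def)

text \<open>The torsion part is trivial, so the free part is the whole group and every isometric
  finite quotient is a fold, to which the index bound applies.\<close>

lemma order_isometric_quotient_ge_6:
  assumes "isometric_finite_quotient diamond_V diamond_E X H"
  shows "6 \<le> order (host X Mod H)"
proof -
  have "H \<subseteq> free_part X (singleton_group ()) 2 diamond_iso"
    using assms free_part_eq_carrier
    by (auto simp: isometric_finite_quotient_def dest: subgroup.subset)
  then have "H \<in> K ` {L. finite_index_sublattice 2 L \<and> passes_exact_check diamond_V diamond_E (fold_X L)}"
    using bij_betw_folds_quotients[OF finite_connected_diamond labelled] assms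
    by (auto simp: bij_betw_def)
  then obtain L where L: "finite_index_sublattice 2 L" "diamond_avoids L" "H = K L"
    using diamond_passes_iff(1) by blast
  then show ?thesis
    using diamond_avoids_index[OF L(1,2)] order_diamond_fold[OF L(1)]
    by (simp add: fold_by_def quotient_embedding_def)
qed

lemma octahedral_host:
  "\<exists>\<theta> \<in> iso (host (fold_X octahedral_lattice)) Z2xZ3.
     \<theta> ` connection_set (fold_X octahedral_lattice)
       = {(0, 1), inv\<^bsub>Z2xZ3\<^esub> (0, 1), (1, 1), inv\<^bsub>Z2xZ3\<^esub> (1, 1)}"
proof -
  let ?L = octahedral_lattice
  have L: "subgroup ?L (Zvec 2)"
    using octahedral_lattice(1) by (simp add: finite_index_sublattice_def)
  \<comment> \<open>The two residues are the ones that cut out the lattice in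
    \<open>octahedral_lattice\<close>, so the kernel of \<open>h\<close> is the kernel of the
    fold.\<close>
  define h where "h = (\<lambda>x. (free_coord x $ 1 mod 2, (free_coord x $ 0 + free_coord x $ 1) mod 3))"
  have fc: "free_coord x \<in> carrier_vec 2" if "x \<in> carrier (host X)" for x
    using free_coord_hom(1)[OF that that] .
  have h_range: "h x \<in> carrier Z2xZ3" for x
  proof -
    have "m mod 2 = 0 \<or> m mod 2 = 1" "n mod 3 = 0 \<or> n mod 3 = 1 \<or> n mod 3 = 2" for m n :: int
      by presburger+
    then show ?thesis
      unfolding h_def Z2xZ3_simps by blast
  qed
  have "h (x \<otimes>\<^bsub>host X\<^esub> y) = h x \<otimes>\<^bsub>Z2xZ3\<^esub> h y"
    if x: "x \<in> carrier (host X)" and y: "y \<in> carrier (host X)" for x y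
  proof -
    have "free_coord (x \<otimes>\<^bsub>host X\<^esub> y) $ i = free_coord x $ i + free_coord y $ i" if "i < 2" for i
      using free_coord_hom(2)[OF x y] fc[OF x] fc[OF y] that by simp
    from this[of 0] this[of 1] show ?thesis
      by (simp add: h_def Z2xZ3_simps mod_add_eq) (simp add: add_ac)
  qed
  then have "h \<in> hom (host X) Z2xZ3"
    using h_range by (intro homI)
  then interpret h: group_hom "host X" Z2xZ3 h
    using group_Z2xZ3 by (simp add: group_hom_def group_hom_axioms_def)
  have ker: "kernel (host X) Z2xZ3 h = K ?L"
  proof (rule Set.set_eqI)
    fix x
    have "h x = (0, 0) \<longleftrightarrow> free_coord x \<in> ?L" if "x \<in> carrier (host X)"
    proof -
      have "free_coord x \<in> ?L \<longleftrightarrow> even (free_coord x $ 1) \<and> 3 dvd free_coord x $ 0 + free_coord x $ 1"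
        using octahedral_lattice(3) vec2_eta[OF fc[OF that]] by metis
      then show ?thesis
        by (simp add: h_def dvd_eq_mod_eq_0)
    qed
    moreover have "x \<in> K ?L \<Longrightarrow> x \<in> carrier (host X)"
      by (simp add: fold_kernel_def)
    ultimately show "x \<in> kernel (host X) Z2xZ3 h \<longleftrightarrow> x \<in> K ?L"
      using mem_fold_kernel_iff[of x ?L] by (auto simp: kernel_def)
  qed
  have "h ` carrier (host X) = carrier Z2xZ3"
  proof
    show "carrier Z2xZ3 \<subseteq> h ` carrier (host X)"
    proof
      fix q assume "q \<in> carrier Z2xZ3"
      then obtain i j where q: "q = (i, j)" "i \<in> {0, 1}" "j \<in> {0, 1, 2}"
        unfolding Z2xZ3_simps by blast
      \<comment> \<open>Solves second coordinate \<open>i\<close> and coordinate sum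
        \<open>j\<close>.\<close>
      have "((), vec2 (j - i) i) \<in> diamond_iso ` carrier (host X)"
        using bij by (simp add: bij_betw_def monoid_vec_simps)
      then obtain x where "x \<in> carrier (host X)" "diamond_iso x = ((), vec2 (j - i) i)"
        by (metis imageE)
      then have x: "x \<in> carrier (host X)" "free_coord x = vec2 (j - i) i"
        by (simp_all add: free_coord_def)
      then have "h x = q"
        using q by (auto simp: h_def)
      then show "q \<in> h ` carrier (host X)" using x by blast
    qed
  qed (use h_range in blast)
  from h.FactGroup_iso_set[OF this]
  have iso: "(\<lambda>C. the_elem (h ` C)) \<in> iso (host (fold_X ?L)) Z2xZ3"
    by (simp add: ker fold_by_def quotient_embedding_def)
  have \<theta>: "the_elem (h ` (K ?L #>\<^bsub>host X\<^esub> x)) = h x" if "x \<in> carrier (host X)" for x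
    using h.the_elem_image_coset_kernel[OF that] by (simp only: ker)
  let ?A = "set (gens X) \<union> m_inv (host X) ` set (gens X)"
  have g: "g \<in> carrier (host X)" if "g \<in> set (gens X)" for g
    using labelled that by (auto simp: labelled_in_comm_group_def)
  have A: "?A \<subseteq> carrier (host X)"
    using g by auto
  have "h ` set (gens X) = (\<lambda>c. (c $ 1 mod 2, (c $ 0 + c $ 1) mod 3)) ` set (map free_coord (gens X))"
    by (simp only: h_def image_image set_map)
  also have "\<dots> = {(0, 1), (1, 2), (1, 1)}"
    unfolding diamond_coord_gens by simp
  finally have hg: "h ` set (gens X) = {(0, 1), (1, 2), (1, 1)}" .
  have "h ` m_inv (host X) ` set (gens X) = m_inv Z2xZ3 ` h ` set (gens X)"
    unfolding image_image using g by (intro image_cong refl h.hom_inv)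
  also have "\<dots> = {(0, 2), (1, 1), (1, 2)}"
    unfolding hg by (simp add: Z2xZ3_simps inv_DirProd carrier_integer_mod_group)
  finally have hi: "h ` m_inv (host X) ` set (gens X) = {(0, 2), (1, 1), (1, 2)}" .
  \<comment> \<open>Six signed generators leave four elements: the generators \<open>(1,1)\<close>
    and \<open>(0,1)\<close> of the plane become mutually inverse in the quotient, so each merges
    with the inverse of the other.\<close>
  have hA: "h ` ?A = {(0, 1), (0, 2), (1, 1), (1, 2)}"
    unfolding image_Un hg hi by auto
  \<comment> \<open>No signed generator becomes trivial, so deleting the identity from the
    connection set removes nothing and its image is all of the set computed in
    \<open>hA\<close>.\<close>
  have ne: "K ?L #>\<^bsub>host X\<^esub> x \<noteq> K ?L" if "x \<in> ?A" for x
  proof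
    assume "K ?L #>\<^bsub>host X\<^esub> x = K ?L"
    then have "x \<in> kernel (host X) Z2xZ3 h"
      using G.coset_join1[OF _ _ subgroup_fold_kernel[OF L]] that A ker by blast
    then have "h x = (0, 0)"
      by (simp add: kernel_def)
    then have "(0, 0) \<in> h ` ?A"
      using that by (metis imageI)
    then show False unfolding hA by simp
  qed
  have "K ?L \<notin> (\<lambda>x. K ?L #>\<^bsub>host X\<^esub> x) ` ?A"
  proof
    assume "K ?L \<in> (\<lambda>x. K ?L #>\<^bsub>host X\<^esub> x) ` ?A"
    then obtain x where "K ?L = K ?L #>\<^bsub>host X\<^esub> x" "x \<in> ?A"
      by (rule imageE)
    from this(1)[symmetric] ne[OF this(2)] show False by (rule notE[rotated])
  qed
  then have "connection_set (fold_X ?L) = (\<lambda>x. K ?L #>\<^bsub>host X\<^esub> x) ` ?A"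
    unfolding fold_by_def connection_set_quotient[OF labelled subgroup_fold_kernel[OF L]]
    by (rule trans[OF Diff_insert0 Diff_empty])
  then have "(\<lambda>C. the_elem (h ` C)) ` connection_set (fold_X ?L) = h ` ?A"
    using A \<theta> by (simp only: image_image) (intro image_cong refl, blast)
  then show ?thesis
    unfolding hA Z2xZ3_simps(4,5) by (intro bexI[OF _ iso])
qed

end

text \<open>The last two conjuncts make precise that diagonal folds miss the optimum: 6 is a lower
  bound over all isometric finite quotients of the diamond, and every passing diagonal fold exceeds
  it.\<close>

theorem theorem8:
  shows
  "(\<forall>(V :: 'v set) E Fs Bs r P (T :: 't monoid) f \<psi>.
      finite_connected_graph V E \<longrightarrow>
      oriented_partition E Fs \<longrightarrow>
      cycle_basis V E Bs \<longrightarrow>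
      root_paths V E r P \<longrightarrow>
      comm_group T \<longrightarrow> finite (carrier T) \<longrightarrow>
      \<psi> \<in> iso (univ_group Fs Bs) (T \<times>\<times> Zvec f) \<longrightarrow>
      (let X = universal_embedding Fs Bs P;
           quotients = {H. isometric_finite_quotient V E X H};
           passing = {L. finite_index_sublattice f L \<and> passes_exact_check V E (fold_by X T \<psi> L)}
       in
         bij_betw (fold_kernel X T \<psi>) passing {H \<in> quotients. H \<subseteq> free_part X T f \<psi>} \<and>
         (carrier T = {\<one>\<^bsub>T\<^esub>} \<longrightarrow> bij_betw (fold_kernel X T \<psi>) passing quotients) \<and>
         (\<forall>N>0. row_lattice ` set (hnf_list f N)
                  = {L. finite_index_sublattice f L \<and> lattice_index f L = N}) \<and>
         (case hnf_search f (\<lambda>B. passes_exact_check V E (fold_by X T \<psi> (row_lattice B))) of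
            None \<Rightarrow> passing = {}
          | Some B \<Rightarrow> row_lattice B \<in> passing \<and>
              (\<forall>L \<in> passing. order (host (fold_by X T \<psi> (row_lattice B)))
                               \<le> order (host (fold_by X T \<psi> L))))))
   \<and>
   finite_connected_graph diamond_V diamond_E \<and>
   oriented_partition diamond_E diamond_F \<and>
   (\<forall>Bs P.
      cycle_basis diamond_V diamond_E Bs \<longrightarrow>
      root_paths diamond_V diamond_E 0 P \<longrightarrow>
      (let X = universal_embedding diamond_F Bs P;
           T = singleton_group ();
           L\<^sub>0 = row_lattice (mat_of_rows_list 2 [[3, 0], [1, 2]])
       in \<exists>\<psi> \<in> iso (host X) (T \<times>\<times> Zvec 2).
         map (\<lambda>g. snd (\<psi> g)) (gens X) = map vec_of_list [[1, 0], [1, 1], [0, 1]] \<and>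
         map (\<lambda>v. snd (\<psi> (lab X v))) [0, 1, 2, 3]
           = map vec_of_list [[0, 0], [1, 0], [1, 1], [2, 1]] \<and>
         (\<forall>L. finite_index_sublattice 2 L \<and> diagonal_lattice 2 L \<and> lattice_index 2 L = 6 \<longrightarrow>
            \<not> passes_exact_check diamond_V diamond_E (fold_by X T \<psi> L)) \<and>
         finite_index_sublattice 2 L\<^sub>0 \<and> \<not> diagonal_lattice 2 L\<^sub>0 \<and> lattice_index 2 L\<^sub>0 = 6 \<and>
         passes_exact_check diamond_V diamond_E (fold_by X T \<psi> L\<^sub>0) \<and>
         isometric_finite_quotient diamond_V diamond_E X (fold_kernel X T \<psi> L\<^sub>0) \<and>
         order (host (fold_by X T \<psi> L\<^sub>0)) = 6 \<and>
         (\<exists>\<theta> \<in> iso (host (fold_by X T \<psi> L\<^sub>0)) (integer_mod_group 2 \<times>\<times> integer_mod_group 3).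
            \<theta> ` connection_set (fold_by X T \<psi> L\<^sub>0)
              = (let Q = integer_mod_group 2 \<times>\<times> integer_mod_group 3
                 in {(0, 1), inv\<^bsub>Q\<^esub> (0, 1), (1, 1), inv\<^bsub>Q\<^esub> (1, 1)})) \<and>
         (let Q = integer_mod_group 2 \<times>\<times> integer_mod_group 3
          in graph_isomorphic
               (carrier Q) (cayley_edges Q {(0, 1), inv\<^bsub>Q\<^esub> (0, 1), (1, 1), inv\<^bsub>Q\<^esub> (1, 1)})
               octahedron_V octahedron_E) \<and>
         (\<forall>H. isometric_finite_quotient diamond_V diamond_E X H \<longrightarrow> 6 \<le> order (host X Mod H)) \<and>
         (\<forall>L. finite_index_sublattice 2 L \<and> diagonal_lattice 2 L \<and>
              passes_exact_check diamond_V diamond_E (fold_by X T \<psi> L) \<longrightarrow>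
            6 < order (host (fold_by X T \<psi> L)))))"
proof (intro conjI allI impI)
  fix V :: "'v set" and E Fs Bs r P and T :: "'t monoid" and f \<psi>
  assume V: "finite_connected_graph V E" and Fs: "oriented_partition E Fs"
    and P: "root_paths V E r P" and T: "comm_group T" "finite (carrier T)"
    and \<psi>: "\<psi> \<in> iso (univ_group Fs Bs) (T \<times>\<times> Zvec f)"
  let ?X = "universal_embedding Fs Bs P"
  interpret free_part_decomposition ?X T f \<psi>
    by (rule universal_embedding_decomposition[OF T(1) \<psi>])
  have X: "labelled_in_comm_group V ?X"
    by (rule labelled_universal_embedding[OF Fs P])
  \<comment> \<open>For trivial torsion the free part is the whole group, which lifts the
    restriction on the kernels and gives the unrestricted correspondence.\<close>
  have all: "H \<subseteq> free_part ?X T f \<psi>"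
    if "carrier T = {\<one>\<^bsub>T\<^esub>}" "isometric_finite_quotient V E ?X H" for H
    using that free_part_eq_carrier
    by (auto simp: isometric_finite_quotient_def dest: subgroup.subset)
  have folds: "bij_betw K {L. finite_index_sublattice f L \<and> passes_exact_check V E (fold_by ?X T \<psi> L)}
      {H \<in> {H. isometric_finite_quotient V E ?X H}. H \<subseteq> free_part ?X T f \<psi>}"
    using bij_betw_folds_quotients[OF V X T(2)] by (simp only: mem_Collect_eq)
  moreover have "bij_betw K {L. finite_index_sublattice f L \<and> passes_exact_check V E (fold_by ?X T \<psi> L)}
      {H. isometric_finite_quotient V E ?X H}" if "carrier T = {\<one>\<^bsub>T\<^esub>}"
  proof -
    have "{H \<in> {H. isometric_finite_quotient V E ?X H}. H \<subseteq> free_part ?X T f \<psi>} =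
        {H. isometric_finite_quotient V E ?X H}"
      using all[OF that] by blast
    then show ?thesis using folds by (simp only:)
  qed
  moreover note hnf_list_enumerates_sublattices hnf_search_minimal_host[of V E]
  ultimately show "let X = ?X;
           quotients = {H. isometric_finite_quotient V E X H};
           passing = {L. finite_index_sublattice f L \<and> passes_exact_check V E (fold_by X T \<psi> L)}
       in
         bij_betw (fold_kernel X T \<psi>) passing {H \<in> quotients. H \<subseteq> free_part X T f \<psi>} \<and>
         (carrier T = {\<one>\<^bsub>T\<^esub>} \<longrightarrow> bij_betw (fold_kernel X T \<psi>) passing quotients) \<and>
         (\<forall>N>0. row_lattice ` set (hnf_list f N)
                  = {L. finite_index_sublattice f L \<and> lattice_index f L = N}) \<and>
         (case hnf_search f (\<lambda>B. passes_exact_check V E (fold_by X T \<psi> (row_lattice B))) of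
            None \<Rightarrow> passing = {}
          | Some B \<Rightarrow> row_lattice B \<in> passing \<and>
              (\<forall>L \<in> passing. order (host (fold_by X T \<psi> (row_lattice B)))
                               \<le> order (host (fold_by X T \<psi> L))))"
    unfolding Let_def by (intro conjI impI allI)
next
  show "finite_connected_graph diamond_V diamond_E"
    by (rule finite_connected_diamond)
  show "oriented_partition diamond_E diamond_F"
    by (rule oriented_partition_diamond)
next
  fix Bs P
  assume "cycle_basis diamond_V diamond_E Bs" "root_paths diamond_V diamond_E 0 P"
  then interpret diamond_embedding Bs P
    by unfold_locales
  have V: "0 \<in> diamond_V" "1 \<in> diamond_V" "2 \<in> diamond_V" "3 \<in> diamond_V"
    by (simp_all add: diamond_V_def)
  have gens: "map (\<lambda>g. snd (diamond_iso g)) (gens X) = map vec_of_list [[1, 0], [1, 1], [0, 1]]"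
    using diamond_coord_gens unfolding free_coord_def vec2_def list.map .
  have labs: "map (\<lambda>v. snd (diamond_iso (lab X v))) [0, 1, 2, 3]
      = map vec_of_list [[0, 0], [1, 0], [1, 1], [2, 1]]"
    using diamond_coord_lab[OF V(1)] diamond_coord_lab[OF V(2)] diamond_coord_lab[OF V(3)]
      diamond_coord_lab[OF V(4)]
    by (simp add: free_coord_def diamond_pos_def vec2_def)
  have diagonal_fails: "\<not> passes_exact_check diamond_V diamond_E (fold_X L)"
    if "finite_index_sublattice 2 L \<and> diagonal_lattice 2 L \<and> lattice_index 2 L = 6" for L
    using that diamond_passes_iff(1) diagonal_index_6_not_avoids by blast
  have order: "order (host (fold_X octahedral_lattice)) = 6"
    using order_diamond_fold[OF octahedral_lattice(1)] octahedral_lattice(2) by (rule trans)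
  \<comment> \<open>The general bound gives at least 6, and the failure of all diagonal folds of
    index 6 makes it strict.\<close>
  have diagonal_larger: "6 < order (host (fold_X L))"
    if L: "finite_index_sublattice 2 L \<and> diagonal_lattice 2 L \<and>
      passes_exact_check diamond_V diamond_E (fold_X L)" for L
  proof -
    have "6 \<le> lattice_index 2 L" "lattice_index 2 L \<noteq> 6"
      using L diamond_passes_iff(1) diamond_avoids_index diagonal_fails by blast+
    then show ?thesis
      using L order_diamond_fold by simp
  qed
  show "let X = X; T = singleton_group (); L\<^sub>0 = octahedral_lattice
       in \<exists>\<psi> \<in> iso (host X) (T \<times>\<times> Zvec 2).
         map (\<lambda>g. snd (\<psi> g)) (gens X) = map vec_of_list [[1, 0], [1, 1], [0, 1]] \<and>
         map (\<lambda>v. snd (\<psi> (lab X v))) [0, 1, 2, 3]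
           = map vec_of_list [[0, 0], [1, 0], [1, 1], [2, 1]] \<and>
         (\<forall>L. finite_index_sublattice 2 L \<and> diagonal_lattice 2 L \<and> lattice_index 2 L = 6 \<longrightarrow>
            \<not> passes_exact_check diamond_V diamond_E (fold_by X T \<psi> L)) \<and>
         finite_index_sublattice 2 L\<^sub>0 \<and> \<not> diagonal_lattice 2 L\<^sub>0 \<and> lattice_index 2 L\<^sub>0 = 6 \<and>
         passes_exact_check diamond_V diamond_E (fold_by X T \<psi> L\<^sub>0) \<and>
         isometric_finite_quotient diamond_V diamond_E X (fold_kernel X T \<psi> L\<^sub>0) \<and>
         order (host (fold_by X T \<psi> L\<^sub>0)) = 6 \<and>
         (\<exists>\<theta> \<in> iso (host (fold_by X T \<psi> L\<^sub>0)) (integer_mod_group 2 \<times>\<times> integer_mod_group 3).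
            \<theta> ` connection_set (fold_by X T \<psi> L\<^sub>0)
              = (let Q = integer_mod_group 2 \<times>\<times> integer_mod_group 3
                 in {(0, 1), inv\<^bsub>Q\<^esub> (0, 1), (1, 1), inv\<^bsub>Q\<^esub> (1, 1)})) \<and>
         (let Q = integer_mod_group 2 \<times>\<times> integer_mod_group 3
          in graph_isomorphic
               (carrier Q) (cayley_edges Q {(0, 1), inv\<^bsub>Q\<^esub> (0, 1), (1, 1), inv\<^bsub>Q\<^esub> (1, 1)})
               octahedron_V octahedron_E) \<and>
         (\<forall>H. isometric_finite_quotient diamond_V diamond_E X H \<longrightarrow> 6 \<le> order (host X Mod H)) \<and>
         (\<forall>L. finite_index_sublattice 2 L \<and> diagonal_lattice 2 L \<and>
              passes_exact_check diamond_V diamond_E (fold_by X T \<psi> L) \<longrightarrow>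
            6 < order (host (fold_by X T \<psi> L)))"
    unfolding Let_def
    by (intro bexI[OF _ diamond_iso] conjI allI impI gens labs diagonal_fails octahedral_lattice(1,2)
        octahedral_lattice_not_diagonal order octahedral_host octahedron_isomorphic
        order_isometric_quotient_ge_6 diagonal_larger
        diamond_passes_iff[OF octahedral_lattice(1), THEN iffD2] octahedral_lattice_avoids)
      (simp_all only:)
qed

end
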